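(* Let $k$ be a positive integer. As operators on the ring $\mathrm{Sym}(2k)$ of symmetric polynomials in $x_1,\ldots,x_{2k}$ with coefficients in $\mathbb Z[\tfrac12]$, $$\nabla_k^D(2k)=x_1\cdots x_{2k}\,\nabla_{2k}^B(2k)+x_1\cdots x_{2k-1}\,\nabla_{2k-1}^B(2k).$$
   Context: All operators act on what is written to their left, so products of operators are performed from left to right; polynomials used as operators act by multiplication (so $x_1\cdots x_m\nabla$ means: first multiply by $x_1\cdots x_m$, then apply $\nabla$). Simple divided differences on polynomials in $x_1,\ldots,x_n$: for $1\le i\le n-1$, $f\,\partial_i=\dfrac{f-f(\ldots,x_{i+1},x_i,\ldots)}{x_i-x_{i+1}}$ ($x_i$ and $x_{i+1}$ exchanged); $f\,\partial_0=\dfrac{f-f(-x_1,x_2,\ldots)}{-x_1}$; $f\,\partial_\heartsuit=\dfrac{f-f(-x_2,-x_1,x_3,\ldots)}{-x_1-x_2}$. For $k\le n$: $\nabla_k^B(n)=(\partial_0\partial_1\cdots\partial_{n-1})(\partial_0\partial_1\cdots\partial_{n-2})\cdots(\partial_0\partial_1\cdots\partial_{n-k})$, a product of $k$ factors. For $k\le n/2$: $\nabla_k^D(n)=(\partial_\heartsuit\partial_2\cdots\partial_{n-1}\,\partial_1\partial_2\cdots\partial_{n-2})(\partial_\heartsuit\partial_2\cdots\partial_{n-3}\,\partial_1\cdots\partial_{n-4})\cdots(\partial_\heartsuit\partial_2\cdots\partial_{n-2k+1}\,\partial_1\partial_2\cdots\partial_{n-2k})$, a product of $k$ factors (runs such as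 $\partial_2\cdots\partial_1$ or $\partial_1\cdots\partial_0$ are empty, so e.g. $\nabla_1^D(2)=\partial_\heartsuit$). *)

theory Defs
  imports Complex_Main "HOL-Library.Poly_Mapping" "HOL-Combinatorics.Permutations"
begin

text \<open>The coefficient ring $\mathbf{Z}[1/2]$, realised inside the rationals.\<close>

typedef dyadic = "{x :: rat. \<exists>(a :: int) (m :: nat). x = of_int a / 2 ^ m}"
  morphisms rat_of_dyadic Abs_dyadic
  by (rule exI[of _ 0]) auto

setup_lifting type_definition_dyadic

instantiation dyadic :: idom
begin

lift_definition zero_dyadic :: dyadic is 0
  by (rule exI[of _ 0]) simp

lift_definition one_dyadic :: dyadic is 1
  by (rule exI[of _ 1], rule exI[of _ 0]) simp

lift_definition plus_dyadic :: "dyadic \<Rightarrow> dyadic \<Rightarrow> dyadic" is "(+)"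
proof (elim exE)
  fix x y :: rat and a b m n
  assume xy: "x = of_int a / 2 ^ m" "y = of_int b / 2 ^ n"
  have "x + y = of_int (a * 2 ^ n + b * 2 ^ m) / 2 ^ (m + n)"
    unfolding xy by (simp add: field_simps power_add)
  then show "\<exists>c k. x + y = of_int c / 2 ^ k" by blast
qed

lift_definition uminus_dyadic :: "dyadic \<Rightarrow> dyadic" is uminus
proof (elim exE)
  fix x :: rat and a m
  assume "x = of_int a / 2 ^ m"
  then have "- x = of_int (- a) / 2 ^ m" by simp
  then show "\<exists>c k. - x = of_int c / 2 ^ k" by blast
qed

lift_definition minus_dyadic :: "dyadic \<Rightarrow> dyadic \<Rightarrow> dyadic" is "(-)"
proof (elim exE)
  fix x y :: rat and a b m n
  assume xy: "x = of_int a / 2 ^ m" "y = of_int b / 2 ^ n"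
  have "x - y = of_int (a * 2 ^ n - b * 2 ^ m) / 2 ^ (m + n)"
    unfolding xy by (simp add: field_simps power_add)
  then show "\<exists>c k. x - y = of_int c / 2 ^ k" by blast
qed

lift_definition times_dyadic :: "dyadic \<Rightarrow> dyadic \<Rightarrow> dyadic" is "(*)"
proof (elim exE)
  fix x y :: rat and a b m n
  assume xy: "x = of_int a / 2 ^ m" "y = of_int b / 2 ^ n"
  have "x * y = of_int (a * b) / 2 ^ (m + n)"
    unfolding xy by (simp add: field_simps power_add)
  then show "\<exists>c k. x * y = of_int c / 2 ^ k" by blast
qed

instance
  by standard (transfer; simp add: algebra_simps)+

end

text \<open>
  Polynomials in the countably many variables $x_0, x_1, x_2, \ldots$, as finitely supported
  maps from exponent vectors to coefficients; the polynomials in $x_1, \ldots, x_n$ are those in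
  which only these variables occur.
\<close>

type_synonym poly = "(nat \<Rightarrow>\<^sub>0 nat) \<Rightarrow>\<^sub>0 dyadic"

definition Var :: "nat \<Rightarrow> poly" where
  "Var i = Poly_Mapping.single (Poly_Mapping.single i 1) 1"

definition Const :: "dyadic \<Rightarrow> poly" where
  "Const c = Poly_Mapping.single 0 c"

definition subst :: "(nat \<Rightarrow> poly) \<Rightarrow> poly \<Rightarrow> poly" where
  "subst \<sigma> f = (\<Sum>m \<in> Poly_Mapping.keys f.
    Const (Poly_Mapping.lookup f m) * (\<Prod>i \<in> Poly_Mapping.keys m. \<sigma> i ^ Poly_Mapping.lookup m i))"

definition Sym :: "nat \<Rightarrow> poly set" where
  "Sym n = {f. (\<forall>m \<in> Poly_Mapping.keys f. Poly_Mapping.keys m \<subseteq> {1..n}) \<and>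
               (\<forall>\<pi>. \<pi> permutes {1..n} \<longrightarrow> subst (\<lambda>i. Var (\<pi> i)) f = f)}"

text \<open>
  The ring of polynomials is an integral domain, so there is at most one quotient. In all three
  divided differences the quotient exists, see \<open>dd_mult\<close>, \<open>dd0_mult\<close> and \<open>dd_heart_mult\<close> below.
\<close>

definition quotient :: "poly \<Rightarrow> poly \<Rightarrow> poly" where
  "quotient f d = (THE q. q * d = f)"

definition dd_pos :: "nat \<Rightarrow> poly \<Rightarrow> poly" where
  "dd_pos i f =
    quotient (f - subst (Var(i := Var (i + 1), i + 1 := Var i)) f) (Var i - Var (i + 1))"

definition dd_zero :: "poly \<Rightarrow> poly" where
  "dd_zero f = quotient (f - subst (Var(1 := - Var 1)) f) (- Var 1)"

definition dd_heart :: "poly \<Rightarrow> poly" where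
  "dd_heart f = quotient (f - subst (Var(1 := - Var 2, 2 := - Var 1)) f) (- Var 1 - Var 2)"

definition dd :: "nat \<Rightarrow> poly \<Rightarrow> poly" where
  "dd i = (if i = 0 then dd_zero else dd_pos i)"

text \<open>Operators act on their left: the head of the list is applied first.\<close>

definition apply_ops :: "(poly \<Rightarrow> poly) list \<Rightarrow> poly \<Rightarrow> poly" where
  "apply_ops Ds f = fold (\<lambda>D g. D g) Ds f"

text \<open>The \<open>j\<close>-th factor is $\partial_0 \partial_1 \cdots \partial_{n-j}$.\<close>

definition nablaB :: "nat \<Rightarrow> nat \<Rightarrow> poly \<Rightarrow> poly" where
  "nablaB k n = apply_ops (concat (map (\<lambda>j. map dd [0..<n - j + 1]) [1..<k + 1]))"

text \<open>
  The \<open>j\<close>-th factor is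
  $\partial_\heartsuit \partial_2 \cdots \partial_{n-2j+1} \, \partial_1 \cdots \partial_{n-2j}$.
\<close>

definition nablaD :: "nat \<Rightarrow> nat \<Rightarrow> poly \<Rightarrow> poly" where
  "nablaD k n = apply_ops (concat (map (\<lambda>j.
      dd_heart # map dd [2..<n - 2 * j + 2] @ map dd [1..<n - 2 * j + 1]) [1..<k + 1]))"

lemma quotient_mult:
  assumes "d \<noteq> 0" "d dvd f"
  shows "quotient f d * d = f"
proof -
  obtain q where q: "f = d * q" using assms(2) by (auto simp: dvd_def)
  have "quotient f d = q"
    unfolding quotient_def by (rule the_equality) (use assms(1) q in \<open>auto simp: mult.commute\<close>)
  then show ?thesis using q by (simp add: mult.commute)
qed

lemma Var_power: "Var i ^ e = Poly_Mapping.single (Poly_Mapping.single i e) 1"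
  by (induction e) (simp_all add: Var_def mult_single single_add[symmetric])

lemma monom_eq: "(\<Prod>i \<in> Poly_Mapping.keys m. Var i ^ Poly_Mapping.lookup m i) = Poly_Mapping.single m 1"
proof -
  have *: "(\<Prod>i \<in> A. Var i ^ e i) = Poly_Mapping.single (\<Sum>i \<in> A. Poly_Mapping.single i (e i)) 1"
    if "finite A" for A e
    using that by induction (simp_all add: Var_power mult_single)
  have "(\<Sum>i \<in> Poly_Mapping.keys m. Poly_Mapping.single i (Poly_Mapping.lookup m i)) = m"
    by (rule poly_mapping_eqI)
      (simp add: lookup_sum lookup_single when_def in_keys_iff)
  then show ?thesis by (simp add: *)
qed

lemma poly_eq_sum: "f = (\<Sum>m \<in> Poly_Mapping.keys f.
    Const (Poly_Mapping.lookup f m) * (\<Prod>i \<in> Poly_Mapping.keys m. Var i ^ Poly_Mapping.lookup m i))"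
proof -
  have "f = (\<Sum>m \<in> Poly_Mapping.keys f. Poly_Mapping.single m (Poly_Mapping.lookup f m))"
    by (rule poly_mapping_eqI)
      (simp add: lookup_sum lookup_single when_def in_keys_iff)
  then show ?thesis by (simp add: monom_eq Const_def mult_single)
qed

lemma dvd_prod_diff:
  fixes d :: poly
  assumes "\<And>i. i \<in> A \<Longrightarrow> d dvd a i - b i"
  shows "d dvd prod a A - prod b A"
  using assms
proof (induction A rule: infinite_finite_induct)
  case (insert i A)
  have "a i * prod a A - b i * prod b A = (a i - b i) * prod a A + b i * (prod a A - prod b A)"
    by (simp add: algebra_simps)
  moreover have "d dvd (a i - b i) * prod a A" "d dvd b i * (prod a A - prod b A)"
    using insert by (simp_all add: dvd_mult dvd_mult2)
  ultimately show ?case using insert.hyps by (metis dvd_add prod.insert)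
qed simp_all

lemma dvd_subst_diff:
  fixes d :: poly
  assumes "\<And>i. d dvd Var i - \<sigma> i"
  shows "d dvd f - subst \<sigma> f"
proof -
  have pow: "d dvd Var i ^ e - \<sigma> i ^ e" for i e
    using dvd_prod_diff[of "{..<e}" d "\<lambda>_. Var i" "\<lambda>_. \<sigma> i"] assms by simp
  have "f - subst \<sigma> f = (\<Sum>m \<in> Poly_Mapping.keys f. Const (Poly_Mapping.lookup f m) *
      ((\<Prod>i \<in> Poly_Mapping.keys m. Var i ^ Poly_Mapping.lookup m i) -
       (\<Prod>i \<in> Poly_Mapping.keys m. \<sigma> i ^ Poly_Mapping.lookup m i)))"
    by (subst (1) poly_eq_sum) (simp add: subst_def sum_subtractf right_diff_distrib)
  also have "d dvd \<dots>"
    by (intro dvd_sum dvd_mult dvd_prod_diff pow)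
  finally show ?thesis .
qed

lemma lookup_Var: "Poly_Mapping.lookup (Var i) (Poly_Mapping.single j (Suc 0)) = (if i = j then 1 else 0)"
  by (auto simp: Var_def lookup_single when_def poly_mapping_eq_iff fun_eq_iff)

lemma dd_mult:
  assumes "1 \<le> i"
  shows "dd i f * (Var i - Var (i + 1)) = f - subst (Var(i := Var (i + 1), i + 1 := Var i)) f"
proof -
  have "Poly_Mapping.lookup (Var i - Var (i + 1)) (Poly_Mapping.single i 1) = 1"
    by (simp add: lookup_minus lookup_Var)
  then have "Var i - Var (i + 1) \<noteq> 0" by fastforce
  moreover have "Var i - Var (i + 1) dvd Var (i + 1) - Var i"
    by (metis dvd_minus_iff dvd_refl minus_diff_eq)
  ultimately show ?thesis
    using assms unfolding dd_def dd_pos_def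
    by (auto intro!: quotient_mult dvd_subst_diff)
qed

lemma dd0_mult: "dd 0 f * (- Var 1) = f - subst (Var(1 := - Var 1)) f"
proof -
  have "Poly_Mapping.lookup (- Var 1) (Poly_Mapping.single 1 1) = - 1"
    by (simp add: lookup_Var)
  then have "- Var 1 \<noteq> 0" by fastforce
  moreover have "- Var 1 dvd Var 1 + Var 1" by (simp add: dvd_add)
  ultimately show ?thesis
    unfolding dd_def dd_zero_def if_P[OF refl]
    by (intro quotient_mult dvd_subst_diff) auto
qed

lemma dd_heart_mult:
  "dd_heart f * (- Var 1 - Var 2) = f - subst (Var(1 := - Var 2, 2 := - Var 1)) f"
proof -
  have "Poly_Mapping.lookup (- Var 1 - Var 2) (Poly_Mapping.single 1 1) = - 1"
    by (simp add: lookup_Var lookup_minus)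
  then have "- Var 1 - Var 2 \<noteq> 0" by fastforce
  moreover have "- Var 1 - Var 2 dvd Var 1 + Var 2"
    by (rule dvdI[of _ _ "- 1"]) simp
  moreover have "- Var 1 - Var 2 dvd Var 2 + Var 1"
    by (rule dvdI[of _ _ "- 1"]) simp
  ultimately show ?thesis
    unfolding dd_heart_def
    by (intro quotient_mult dvd_subst_diff) auto
qed

end

theory Submission
  imports Defs
begin

text \<open>
  A polynomial is determined by its values at the points with coordinates that are nonzero and
  differ even up to sign, and there the operators act on arbitrary functions by plain division.
  Moving commuting divided differences past each other gives
  $\nabla^B_n(n) = \nabla^B_{n-1}(n-1)\, \partial_{n-1} \cdots \partial_1 \partial_0$,
  $\nabla^B_{n-1}(n) = \nabla^B_{n-1}(n-1)\, \partial_{n-1} \cdots \partial_1$ and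
  $\nabla^D_k(2k) = \nabla^D_{k-1}(2k-2)\, (\partial_{2k-2} \cdots \partial_1)
  (\partial_{2k-1} \cdots \partial_2 \partial_\heartsuit)$. By induction, on symmetric $f$ the
  operators become sums over sign changes $S$ of the variables: with
  $t_S = \bigl(f / \prod_{i<j} (- x_i - x_j)\bigr)^S$,
  the image of $f$ under $x_1 \cdots x_n \nabla^B_n(n)$ is $(-1)^n \sum_S t_S$,
  under $x_1 \cdots x_{n-1} \nabla^B_{n-1}(n)$ it is $(-1)^{n-1}$ times the sum over the $S$ with
  $n - |S|$ odd, and under $\nabla^D_k(2k)$ the sum over the even $S$. The coefficients
  appearing in the induction step are evaluated by
  $\sum_{i \in T} \prod_{j \in T - i} \frac{x_i + x_j}{x_i - x_j} \in \{0, 1\}$ (the parity of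
  $|T|$) and $\sum_{i \in T} x_i \prod_{j \in T - i} \frac{x_i + x_j}{x_i - x_j} = \sum_{i \in T} x_i$.
\<close>

section \<open>Rational function identities\<close>

text \<open>Partial fraction expansion in \<open>z\<close>, with constant term 1 and simple poles at
  the \<open>x i\<close>.\<close>

lemma prod_quotient_partial_fractions:
  fixes x :: "'a \<Rightarrow> 'b :: field"
  assumes "finite T" "inj_on x T" "\<forall>i \<in> T. z \<noteq> x i"
  shows "(\<Prod>j \<in> T. (z + x j) / (z - x j)) =
    1 + (\<Sum>i \<in> T. 2 * x i / (z - x i) * (\<Prod>j \<in> T - {i}. (x i + x j) / (x i - x j)))"
  using assms
proof (induction T arbitrary: z)
  case (insert y T)
  define c where "c T i = (\<Prod>j \<in> T - {i}. (x i + x j) / (x i - x j))" for T i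
  have ne: "z \<noteq> x y" "\<And>i. i \<in> T \<Longrightarrow> z \<noteq> x i" "\<And>i. i \<in> T \<Longrightarrow> x i \<noteq> x y" "\<And>i. i \<in> T \<Longrightarrow> x y \<noteq> x i"
    using insert.prems insert.hyps by (auto simp: inj_on_def)
  have IH: "(\<Prod>j \<in> T. (z + x j) / (z - x j)) = 1 + (\<Sum>i \<in> T. 2 * x i / (z - x i) * c T i)"
    if "\<forall>i \<in> T. z \<noteq> x i" for z
    unfolding c_def using insert.IH that insert.prems by (simp add: inj_on_insert)
  \<comment> \<open>The expansion for \<open>T\<close>, taken at \<open>z = x y\<close>, is the
    coefficient belonging to the new pole.\<close>
  have cy: "c (insert y T) y = 1 + (\<Sum>i \<in> T. 2 * x i / (x y - x i) * c T i)"
    using IH[of "x y"] insert.hyps ne by (simp add: c_def)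
  have ci: "c (insert y T) i = (x i + x y) / (x i - x y) * c T i" if "i \<in> T" for i
    using that insert.hyps by (auto simp: c_def insert_Diff_if)
  \<comment> \<open>Partial fractions for a product of two simple poles, at \<open>x y\<close> and
    at \<open>x i\<close>.\<close>
  have *: "(z + x y) / (z - x y) * (2 * x i / (z - x i)) =
      2 * x y / (z - x y) * (2 * x i / (x y - x i)) + 2 * x i / (z - x i) * ((x i + x y) / (x i - x y))"
    if "i \<in> T" for i
  proof -
    have "x y - x i \<noteq> 0" "x i - x y \<noteq> 0" "z - x y \<noteq> 0" "z - x i \<noteq> 0"
      using ne that by auto
    then show ?thesis by (simp add: divide_simps) (simp add: algebra_simps)
  qed
  have 1: "(z + x y) / (z - x y) = 1 + 2 * x y / (z - x y)"
    using ne by (simp add: field_simps)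
  have "(\<Prod>j \<in> insert y T. (z + x j) / (z - x j)) =
      (z + x y) / (z - x y) + (\<Sum>i \<in> T. (z + x y) / (z - x y) * (2 * x i / (z - x i)) * c T i)"
    using insert.hyps ne by (simp add: IH distrib_left sum_distrib_left mult.assoc)
  also have "\<dots> = 1 + 2 * x y / (z - x y) + (\<Sum>i \<in> T. 2 * x y / (z - x y) * (2 * x i / (x y - x i) * c T i)
      + 2 * x i / (z - x i) * ((x i + x y) / (x i - x y) * c T i))"
    by (intro arg_cong2[of _ _ _ _ "(+)"] 1 sum.cong refl)
      (subst *, assumption, simp only: distrib_right mult.assoc)
  also have "\<dots> = 1 + (\<Sum>i \<in> insert y T. 2 * x i / (z - x i) * c (insert y T) i)"
    using insert.hyps by (simp add: cy ci sum.distrib distrib_left sum_distrib_left add_divide_distrib sum_divide_distrib mult_ac)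
  finally show ?case unfolding c_def .
qed simp

text \<open>At \<open>z = 0\<close> every factor of the expanded product is -1 and every
  \<open>2 * x i / (z - x i)\<close> is -2, so twice the sum is
  \<open>1 - (- 1) ^ card T\<close>.\<close>

lemma sum_prod_quotient:
  fixes x :: "'a \<Rightarrow> 'b :: field_char_0"
  assumes "finite T" "inj_on x T" "\<forall>i \<in> T. x i \<noteq> 0"
  shows "(\<Sum>i \<in> T. \<Prod>j \<in> T - {i}. (x i + x j) / (x i - x j)) = (if odd (card T) then 1 else 0)"
proof -
  define s where "s = (\<Sum>i \<in> T. \<Prod>j \<in> T - {i}. (x i + x j) / (x i - x j))"
  have "(\<Prod>j \<in> T. (0 + x j) / (0 - x j)) = (\<Prod>j \<in> T. - 1)"
    using assms by (intro prod.cong) auto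
  then have "(- 1) ^ card T = (\<Prod>j \<in> T. (0 + x j) / (0 - x j))"
    by simp
  also have "\<dots> = 1 + (\<Sum>i \<in> T. 2 * x i / (0 - x i) * (\<Prod>j \<in> T - {i}. (x i + x j) / (x i - x j)))"
    using assms by (intro prod_quotient_partial_fractions) auto
  also have "\<dots> = 1 + (\<Sum>i \<in> T. - 2 * (\<Prod>j \<in> T - {i}. (x i + x j) / (x i - x j)))"
    using assms by (intro arg_cong2[of _ _ _ _ "(+)"] refl sum.cong) auto
  also have "\<dots> = 1 - 2 * s"
    by (simp add: s_def sum_negf sum_distrib_left)
  finally show ?thesis unfolding s_def[symmetric] by (auto split: if_splits simp: algebra_simps)
qed

text \<open>When \<open>y\<close> is added to \<open>T\<close>, the change of each old summand
  cancels against one term in the partial fraction expansion of the new coefficient of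
  \<open>x y\<close>.\<close>

lemma sum_times_prod_quotient:
  fixes x :: "'a \<Rightarrow> 'b :: field"
  assumes "finite T" "inj_on x T"
  shows "(\<Sum>i \<in> T. x i * (\<Prod>j \<in> T - {i}. (x i + x j) / (x i - x j))) = sum x T"
  using assms
proof (induction T)
  case (insert y T)
  define c where "c T i = (\<Prod>j \<in> T - {i}. (x i + x j) / (x i - x j))" for T i
  have ne: "\<And>i. i \<in> T \<Longrightarrow> x i \<noteq> x y" "\<And>i. i \<in> T \<Longrightarrow> x y \<noteq> x i"
    using insert.prems insert.hyps by (auto simp: inj_on_def)
  have cy: "c (insert y T) y = 1 + (\<Sum>i \<in> T. 2 * x i / (x y - x i) * c T i)"
    using prod_quotient_partial_fractions[of T x "x y"] insert.hyps insert.prems ne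
    by (simp add: c_def inj_on_insert)
  have ci: "c (insert y T) i = (x i + x y) / (x i - x y) * c T i" if "i \<in> T" for i
    using that insert.hyps by (auto simp: c_def insert_Diff_if)
  have *: "x i * c (insert y T) i = x i * c T i - x y * (2 * x i / (x y - x i) * c T i)" if "i \<in> T" for i
  proof -
    have "x y - x i \<noteq> 0" "x i - x y \<noteq> 0"
      using ne that by auto
    then have "x i * ((x i + x y) / (x i - x y)) = x i - x y * (2 * x i / (x y - x i))"
      by (simp add: divide_simps) (simp add: algebra_simps)
    then have "x i * ((x i + x y) / (x i - x y)) * c T i = (x i - x y * (2 * x i / (x y - x i))) * c T i"
      by simp
    then show ?thesis by (simp only: ci[OF that] left_diff_distrib mult.assoc)
  qed
  have "(\<Sum>i \<in> insert y T. x i * c (insert y T) i) = x y + (\<Sum>i \<in> T. x i * c T i)"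
    using insert.hyps by (simp add: cy * sum_subtractf distrib_left sum_distrib_left)
  then show ?case
    using insert by (simp add: c_def inj_on_insert)
qed simp

section \<open>Rearranging products of operators\<close>

text \<open>As \<open>apply_ops\<close>, but over an arbitrary type: it serves for operators on
  polynomials and for operators on functions.\<close>

definition run :: "('b \<Rightarrow> 'b) list \<Rightarrow> 'b \<Rightarrow> 'b" where
  "run Ds = fold (\<lambda>D. D) Ds"

lemma run_Nil [simp]: "run [] a = a"
  and run_Cons [simp]: "run (D # Ds) a = run Ds (D a)"
  and run_append [simp]: "run (Ds @ Es) a = run Es (run Ds a)"
  by (simp_all add: run_def)

lemma run_commute1:
  assumes "\<And>E a. E \<in> set Es \<Longrightarrow> D (E a) = E (D a)"
  shows "D (run Es a) = run Es (D a)"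
  using assms by (induction Es arbitrary: a) simp_all

lemma run_commute:
  assumes "\<And>D E a. D \<in> set Ds \<Longrightarrow> E \<in> set Es \<Longrightarrow> D (E a) = E (D a)"
  shows "run Ds (run Es a) = run Es (run Ds a)"
  using assms
proof (induction Ds arbitrary: a)
  case (Cons D Ds)
  then have "D (run Es a) = run Es (D a)"
    by (intro run_commute1) simp
  moreover have "run Ds (run Es (D a)) = run Es (run Ds (D a))"
    by (rule Cons.IH, rule Cons.prems) simp_all
  ultimately show ?case by simp
qed simp

text \<open>The operator list behind \<open>nablaB\<close> with the operators as a parameter, to be
  instantiated by \<open>dd\<close> on polynomials and by \<open>diff\<close> on functions;
  \<open>rowsD\<close> does the same for \<open>nablaD\<close>.\<close>

definition rowsB :: "(nat \<Rightarrow> 'b \<Rightarrow> 'b) \<Rightarrow> nat \<Rightarrow> nat \<Rightarrow> ('b \<Rightarrow> 'b) list" where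
  "rowsB d k n = concat (map (\<lambda>j. map d [0..<n - j + 1]) [1..<k + 1])"

definition rowsD :: "('b \<Rightarrow> 'b) \<Rightarrow> (nat \<Rightarrow> 'b \<Rightarrow> 'b) \<Rightarrow> nat \<Rightarrow> nat \<Rightarrow> ('b \<Rightarrow> 'b) list" where
  "rowsD h d k n = concat (map (\<lambda>j.
      h # map d [2..<n - 2 * j + 2] @ map d [1..<n - 2 * j + 1]) [1..<k + 1])"

lemma rowsB_Suc: "rowsB d (Suc k) n = rowsB d k n @ map d [0..<n - Suc k + 1]"
  by (simp add: rowsB_def)

lemma rowsD_Suc: "rowsD h d (Suc k) n = rowsD h d k n @
   h # map d [2..<n - 2 * Suc k + 2] @ map d [1..<n - 2 * Suc k + 1]"
  by (simp add: rowsD_def)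

lemma rev_upt_Suc: "m < n \<Longrightarrow> rev [m..<n] = rev [Suc m..<n] @ [m]"
  by (simp add: upt_conv_Cons)

text \<open>Row \<open>j\<close> for \<open>Suc n\<close> is row \<open>j\<close> for
  \<open>n\<close> followed by \<open>d (Suc n - j)\<close>. This operator commutes with the later
  rows for \<open>n\<close>, whose indices are at most \<open>n - j - 1\<close>, so the additional
  operators can be collected at the end.\<close>

lemma run_rowsB_Suc:
  assumes comm: "\<And>i j a. i + 2 \<le> j \<Longrightarrow> d i (d j a) = d j (d i a)" and "k \<le> n"
  shows "run (rowsB d k (Suc n)) a = run (rowsB d k n @ map d (rev [Suc n - k..<Suc n])) a"
  using \<open>k \<le> n\<close>
proof (induction k)
  case 0
  then show ?case by (simp add: rowsB_def)
next
  case (Suc k)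
  define X where "X = [0..<n - k]"
  define Y where "Y = rev [Suc n - k..<Suc n]"
  define b where "b = run (rowsB d k n) a"
  have X: "[0..<Suc n - Suc k + 1] = X @ [n - k]" "[0..<n - Suc k + 1] = X"
    using Suc.prems by (simp_all add: X_def Suc_diff_Suc)
  have Y: "rev [Suc n - Suc k..<Suc n] = Y @ [n - k]"
    using Suc.prems rev_upt_Suc[of "n - k" "Suc n"] by (simp add: Y_def Suc_diff_le)
  have IH: "run (rowsB d k (Suc n)) a = run (map d Y) b"
    using Suc unfolding b_def Y_def by simp
  have "run (map d X) (run (map d Y) b) = run (map d Y) (run (map d X) b)"
    by (rule run_commute) (use Suc.prems in \<open>auto simp: X_def Y_def intro!: comm\<close>)
  then show ?case
    unfolding rowsB_Suc X Y by (simp add: IH b_def)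
qed

text \<open>The case \<open>k = n\<close>; the remaining last row consists of \<open>d 0\<close>
  alone.\<close>

lemma run_rowsB_diag:
  assumes comm: "\<And>i j a. i + 2 \<le> j \<Longrightarrow> d i (d j a) = d j (d i a)"
  shows "run (rowsB d (Suc n) (Suc n)) a = d 0 (run (map d (rev [1..<Suc n])) (run (rowsB d n n) a))"
  using run_rowsB_Suc[of d n n a, OF comm] by (simp add: rowsB_Suc)

text \<open>With two more variables, each of the two runs in a row gains two operators. These move
  to the end, where each of the two descending runs takes one operator from either run of the
  row.\<close>

lemma run_rowsD_Suc:
  assumes comm: "\<And>i j a. i + 2 \<le> j \<Longrightarrow> d i (d j a) = d j (d i a)"
    and comm_h: "\<And>j a. 3 \<le> j \<Longrightarrow> h (d j a) = d j (h a)"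
    and "k \<le> n"
  shows "run (rowsD h d k (2 * Suc n)) a = run (rowsD h d k (2 * n) @
    map d (rev [2 * n + 1 - 2 * k..<2 * n + 1]) @ map d (rev [2 * n + 2 - 2 * k..<2 * n + 2])) a"
  using \<open>k \<le> n\<close>
proof (induction k)
  case 0
  then show ?case by (simp add: rowsD_def)
next
  case (Suc k)
  \<comment> \<open>Since \<open>k < n\<close>, the truncated difference can be written
    \<open>c + 2\<close>, and all index bounds below become sums.\<close>
  obtain c where c: "2 * n - 2 * k = c + 2"
    using Suc.prems that[of "2 * n - 2 * Suc k"] by simp
  have cn: "c + 2 \<le> 2 * n" using c by linarith
  define b where "b = run (rowsD h d k (2 * n)) a"
  define X1 where "X1 = map d [2..<c + 2]"
  define X2 where "X2 = map d [1..<c + 1]"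
  define Y1 where "Y1 = map d (rev [c + 3..<2 * n + 1])"
  define Y2 where "Y2 = map d (rev [c + 4..<2 * n + 2])"
  have m: "2 * Suc n - 2 * Suc k + 2 = Suc (Suc (c + 2))" "2 * Suc n - 2 * Suc k + 1 = Suc (Suc (c + 1))"
    "2 * n - 2 * Suc k + 2 = c + 2" "2 * n - 2 * Suc k + 1 = c + 1"
    using c by simp_all
  have X: "map d [2..<Suc (Suc (c + 2))] = X1 @ [d (c + 2), d (c + 3)]"
    "map d [1..<Suc (Suc (c + 1))] = X2 @ [d (c + 1), d (c + 2)]"
    by (simp_all add: X1_def X2_def numeral_2_eq_2 numeral_3_eq_3)
  have e: "2 * n + 1 - 2 * k = c + 3" "2 * n + 2 - 2 * k = c + 4"
    "2 * n + 1 - 2 * Suc k = c + 1" "2 * n + 2 - 2 * Suc k = c + 2"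
    using c by simp_all
  have "rev [c + 1..<2 * n + 1] = rev [Suc (Suc (c + 1))..<2 * n + 1] @ [Suc (c + 1), c + 1]"
    "rev [c + 2..<2 * n + 2] = rev [Suc (Suc (c + 2))..<2 * n + 2] @ [Suc (c + 2), c + 2]"
    using cn by (subst rev_upt_Suc, simp, subst rev_upt_Suc, simp, simp del: upt_Suc)+
  moreover have "Suc (Suc (c + 1)) = c + 3" "Suc (Suc (c + 2)) = c + 4" "Suc (c + 1) = c + 2" "Suc (c + 2) = c + 3"
    by simp_all
  ultimately have Y: "map d (rev [c + 1..<2 * n + 1]) = Y1 @ [d (c + 2), d (c + 1)]"
    "map d (rev [c + 2..<2 * n + 2]) = Y2 @ [d (c + 3), d (c + 2)]"
    by (simp_all only: Y1_def Y2_def map_append list.map)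
  have IH: "run (rowsD h d k (2 * Suc n)) a = run Y2 (run Y1 b)"
    using Suc unfolding b_def Y1_def Y2_def e by (simp del: upt_Suc)
  \<comment> \<open>The indices in \<open>X1\<close> and \<open>X2\<close> are at most
    \<open>c + 1\<close>, those in \<open>Y1\<close> and \<open>Y2\<close> at least
    \<open>c + 3\<close>.\<close>
  have XY: "run Xs (run Ys z) = run Ys (run Xs z)" if "Xs \<in> {X1, X2}" "Ys \<in> {Y1, Y2}" for Xs Ys z
    by (rule run_commute) (use that in \<open>auto simp: X1_def X2_def Y1_def Y2_def intro!: comm\<close>)
  have hY: "h (run Ys z) = run Ys (h z)" if "Ys \<in> {Y1, Y2}" for Ys z
    by (rule run_commute1) (use that in \<open>auto simp: Y1_def Y2_def intro!: comm_h\<close>)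
  have dY: "d i (run Y2 z) = run Y2 (d i z)" if "i \<in> {c + 1, c + 2}" for i z
    by (rule run_commute1) (use that in \<open>auto simp: Y2_def intro!: comm\<close>)
  have X2d: "run X2 (d i z) = d i (run X2 z)" if "i \<in> {c + 2, c + 3}" for i z
    by (rule run_commute1[symmetric]) (use that in \<open>auto simp: X2_def intro!: comm[symmetric]\<close>)
  \<comment> \<open>Swaps the middle two of the new operators \<open>d (c + 2)\<close>,
    \<open>d (c + 3)\<close>, \<open>d (c + 1)\<close>, \<open>d (c + 2)\<close>.\<close>
  have dd: "d (c + 1) (d (c + 3) z) = d (c + 3) (d (c + 1) z)" for z
    by (rule comm) simp
  show ?case
    unfolding rowsD_Suc m X e Y X1_def[symmetric] X2_def[symmetric]
    by (simp only: run_append run_Cons run_Nil IH b_def[symmetric])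
      (simp only: XY[of X1 Y1] XY[of X1 Y2] XY[of X2 Y1] XY[of X2 Y2] hY dY X2d dd insert_iff simp_thms)
qed

text \<open>The case \<open>k = n\<close>; in the remaining last row both runs are empty and only
  \<open>h\<close> is left.\<close>

lemma run_rowsD_diag:
  assumes "\<And>i j a. i + 2 \<le> j \<Longrightarrow> d i (d j a) = d j (d i a)"
    and "\<And>j a. 3 \<le> j \<Longrightarrow> h (d j a) = d j (h a)"
  shows "run (rowsD h d (Suc n) (2 * Suc n)) a =
    h (run (map d (rev [2..<2 * n + 2])) (run (map d (rev [1..<2 * n + 1])) (run (rowsD h d n (2 * n)) a)))"
  using run_rowsD_Suc[of d h n n a, OF assms] by (simp add: rowsD_Suc)

section \<open>Evaluation at generic points\<close>

definition real_of_dyadic :: "dyadic \<Rightarrow> real" where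
  "real_of_dyadic c = of_rat (rat_of_dyadic c)"

lemma real_of_dyadic_simps [simp]:
  "real_of_dyadic 0 = 0" "real_of_dyadic 1 = 1"
  "real_of_dyadic (a + b) = real_of_dyadic a + real_of_dyadic b"
  "real_of_dyadic (a * b) = real_of_dyadic a * real_of_dyadic b"
  by (simp_all add: real_of_dyadic_def zero_dyadic.rep_eq one_dyadic.rep_eq plus_dyadic.rep_eq
      times_dyadic.rep_eq of_rat_add of_rat_mult)

lemma real_of_dyadic_eq_0_iff [simp]: "real_of_dyadic a = 0 \<longleftrightarrow> a = 0"
  by (metis of_rat_eq_0_iff rat_of_dyadic_inject real_of_dyadic_def zero_dyadic.rep_eq)

definition ev_monom :: "(nat \<Rightarrow> real) \<Rightarrow> (nat \<Rightarrow>\<^sub>0 nat) \<Rightarrow> real" where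
  "ev_monom x m = (\<Prod>i \<in> Poly_Mapping.keys m. x i ^ Poly_Mapping.lookup m i)"

definition ev :: "(nat \<Rightarrow> real) \<Rightarrow> poly \<Rightarrow> real" where
  "ev x f = (\<Sum>m \<in> Poly_Mapping.keys f. real_of_dyadic (Poly_Mapping.lookup f m) * ev_monom x m)"

lemma ev_monom_superset:
  "finite A \<Longrightarrow> Poly_Mapping.keys m \<subseteq> A \<Longrightarrow> ev_monom x m = (\<Prod>i \<in> A. x i ^ Poly_Mapping.lookup m i)"
  unfolding ev_monom_def by (rule prod.mono_neutral_left) (auto simp: in_keys_iff)

lemma ev_superset:
  "finite A \<Longrightarrow> Poly_Mapping.keys f \<subseteq> A \<Longrightarrow>
    ev x f = (\<Sum>m \<in> A. real_of_dyadic (Poly_Mapping.lookup f m) * ev_monom x m)"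
  unfolding ev_def by (rule sum.mono_neutral_left) (auto simp: in_keys_iff)

lemma ev_monom_add: "ev_monom x (m + m') = ev_monom x m * ev_monom x m'"
proof -
  define A where "A = Poly_Mapping.keys m \<union> Poly_Mapping.keys m'"
  have "finite A" "Poly_Mapping.keys m \<subseteq> A" "Poly_Mapping.keys m' \<subseteq> A" "Poly_Mapping.keys (m + m') \<subseteq> A"
    using keys_add[of m m'] by (auto simp: A_def)
  then show ?thesis
    by (simp add: ev_monom_superset lookup_add power_add prod.distrib)
qed

lemma ev_add [simp]: "ev x (f + g) = ev x f + ev x g"
proof -
  define A where "A = Poly_Mapping.keys f \<union> Poly_Mapping.keys g"
  have "finite A" "Poly_Mapping.keys f \<subseteq> A" "Poly_Mapping.keys g \<subseteq> A" "Poly_Mapping.keys (f + g) \<subseteq> A"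
    using keys_add[of f g] by (auto simp: A_def)
  then show ?thesis
    by (simp add: ev_superset[of A] lookup_add sum.distrib distrib_right)
qed

lemma ev_single: "ev x (Poly_Mapping.single m c) = real_of_dyadic c * ev_monom x m"
  by (simp add: ev_superset[of "{m}"])

lemma ev_0 [simp]: "ev x 0 = 0" by (simp add: ev_def)

lemma ev_minus [simp]: "ev x (- f) = - ev x f"
  using ev_add[of x f "- f"] by simp

lemma ev_diff [simp]: "ev x (f - g) = ev x f - ev x g"
  using ev_add[of x f "- g"] by simp

lemma ev_sum [simp]: "ev x (sum F A) = (\<Sum>i \<in> A. ev x (F i))"
  by (induction A rule: infinite_finite_induct) simp_all

lemma sum_single: "(\<Sum>m \<in> Poly_Mapping.keys f. Poly_Mapping.single m (Poly_Mapping.lookup f m)) = f"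
  by (rule poly_mapping_eqI) (simp add: lookup_sum lookup_single when_def in_keys_iff)

lemma ev_mult [simp]: "ev x (f * g) = ev x f * ev x g"
proof -
  have "f * g = (\<Sum>m \<in> Poly_Mapping.keys f. \<Sum>m' \<in> Poly_Mapping.keys g.
      Poly_Mapping.single (m + m') (Poly_Mapping.lookup f m * Poly_Mapping.lookup g m'))"
    by (subst (1) sum_single[of f, symmetric], subst (1) sum_single[of g, symmetric])
      (simp only: sum_product mult_single)
  then show ?thesis
    by (simp add: ev_single ev_monom_add) (simp add: ev_def sum_product mult_ac)
qed

lemma ev_Const [simp]: "ev x (Const c) = real_of_dyadic c"
  by (simp add: Const_def ev_single ev_monom_def)

lemma ev_1 [simp]: "ev x 1 = 1"
  using ev_Const[of x 1] by (simp add: Const_def)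

lemma ev_Var [simp]: "ev x (Var i) = x i"
  by (simp add: Var_def ev_single ev_monom_def)

lemma ev_prod [simp]: "ev x (prod F A) = (\<Prod>i \<in> A. ev x (F i))"
  by (induction A rule: infinite_finite_induct) simp_all

lemma ev_power [simp]: "ev x (f ^ n) = ev x f ^ n"
  by (induction n) simp_all

lemma ev_subst: "ev x (subst \<sigma> f) = ev (\<lambda>i. ev x (\<sigma> i)) f"
  by (simp add: subst_def ev_def[of _ f] ev_monom_def)

section \<open>Generic points and the vanishing of polynomials\<close>

definition generic :: "(nat \<Rightarrow> real) \<Rightarrow> bool" where
  "generic x \<longleftrightarrow> (\<forall>i. x i \<noteq> 0) \<and> (\<forall>i j. i \<noteq> j \<longrightarrow> x i \<noteq> x j \<and> x i \<noteq> - x j)"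

text \<open>Uniqueness of digits in base \<open>B\<close>: reduction modulo \<open>B\<close> yields
  the lowest digit, and cancelling it and then \<open>B\<close> leaves a shorter expansion.\<close>

lemma base_expansion_inj:
  fixes B :: nat
  assumes "\<And>i. a i < B" "\<And>i. b i < B" "(\<Sum>i<n. a i * B ^ i) = (\<Sum>i<n. b i * B ^ i)" "i < n"
  shows "a i = b i"
  using assms
proof (induction n arbitrary: a b i)
  case (Suc n)
  have split: "(\<Sum>i<Suc n. c i * B ^ i) = c 0 + B * (\<Sum>i<n. c (Suc i) * B ^ i)" for c :: "nat \<Rightarrow> nat"
    by (simp add: sum.lessThan_Suc_shift sum_distrib_left mult_ac del: sum.lessThan_Suc)
  have eq: "a 0 + B * (\<Sum>i<n. a (Suc i) * B ^ i) = b 0 + B * (\<Sum>i<n. b (Suc i) * B ^ i)"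
    using Suc.prems(3) unfolding split .
  have B: "B > 0" using Suc.prems(1)[of 0] by simp
  have "a 0 = b 0"
    using arg_cong[OF eq, of "\<lambda>m. m mod B"] Suc.prems(1,2) by simp
  moreover from this have "(\<Sum>i<n. a (Suc i) * B ^ i) = (\<Sum>i<n. b (Suc i) * B ^ i)"
    using eq B by simp
  then have "a (Suc j) = b (Suc j)" if "j < n" for j
    using Suc.IH[of "\<lambda>i. a (Suc i)" "\<lambda>i. b (Suc i)" j] Suc.prems that by simp
  ultimately show ?case using Suc.prems(4) by (cases i) auto
qed simp

text \<open>
  Kronecker substitution: at $x_i = t^{B^i}$ with $B$ exceeding all exponents, distinct monomials
  become distinct powers of $t$.
\<close>

lemma generic_nonzero:
  assumes "p \<noteq> 0"
  obtains x where "generic x" "ev x p \<noteq> 0"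
proof -
  define K where "K = Poly_Mapping.keys p"
  define V where "V = (\<Union>m \<in> K. Poly_Mapping.keys m)"
  have fin: "finite K" "finite V" by (auto simp: K_def V_def)
  obtain n where n: "V \<subseteq> {..<n}"
    using fin(2) by (auto simp: finite_nat_set_iff_bounded)
  \<comment> \<open>Larger than every exponent; the summand 2 also gives \<open>B > 1\<close>, so
    that the powers \<open>B ^ i\<close> are distinct.\<close>
  define B where "B = 2 + (\<Sum>m \<in> K. \<Sum>i \<in> V. Poly_Mapping.lookup m i)"
  have small: "Poly_Mapping.lookup m i < B" if "m \<in> K" for m i
  proof (cases "i \<in> Poly_Mapping.keys m")
    case True
    then have "i \<in> V" using that by (auto simp: V_def)
    then have "Poly_Mapping.lookup m i \<le> (\<Sum>i \<in> V. Poly_Mapping.lookup m i)"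
      using fin by (intro member_le_sum) auto
    also have "\<dots> \<le> (\<Sum>m \<in> K. \<Sum>i \<in> V. Poly_Mapping.lookup m i)"
      using fin that by (intro member_le_sum[of m K "\<lambda>m. \<Sum>i \<in> V. Poly_Mapping.lookup m i"]) auto
    finally show ?thesis by (simp add: B_def)
  qed (simp add: B_def in_keys_iff)
  define w where "w m = (\<Sum>i<n. Poly_Mapping.lookup m i * B ^ i)" for m :: "nat \<Rightarrow>\<^sub>0 nat"
  have keys: "Poly_Mapping.keys m \<subseteq> {..<n}" if "m \<in> K" for m
    using n that by (auto simp: V_def)
  have inj: "inj_on w K"
  proof (rule inj_onI, rule poly_mapping_eqI)
    fix m m' i assume m: "m \<in> K" "m' \<in> K" "w m = w m'"
    show "Poly_Mapping.lookup m i = Poly_Mapping.lookup m' i"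
    proof (cases "i < n")
      case True
      then show ?thesis
        using base_expansion_inj[of "Poly_Mapping.lookup m" B "Poly_Mapping.lookup m'" n i] m small
        by (simp add: w_def)
    next
      case False
      then show ?thesis using keys[OF m(1)] keys[OF m(2)]
        by (metis in_keys_iff lessThan_iff subsetD)
    qed
  qed
  have ev_eq: "ev (\<lambda>i. t ^ (B ^ i)) p = (\<Sum>m \<in> K. real_of_dyadic (Poly_Mapping.lookup p m) * t ^ w m)" for t
  proof -
    have "ev_monom (\<lambda>i. t ^ (B ^ i)) m = t ^ w m" if "m \<in> K" for m
      by (subst ev_monom_superset[OF _ keys[OF that]])
        (simp_all add: w_def power_sum mult.commute flip: power_mult)
    then show ?thesis by (simp add: ev_def flip: K_def)
  qed
  define N where "N = (\<Sum>m \<in> K. w m)"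
  have wN: "w m \<le> N" if "m \<in> K" for m
    unfolding N_def using fin that by (intro member_le_sum) auto
  \<comment> \<open>The coefficient of \<open>t ^ e\<close>; as \<open>w\<close> is injective on
    \<open>K\<close>, at most one monomial contributes.\<close>
  define c where "c e = (\<Sum>m \<in> {m \<in> K. w m = e}. real_of_dyadic (Poly_Mapping.lookup p m))" for e
  have c: "c (w m) = real_of_dyadic (Poly_Mapping.lookup p m)" if "m \<in> K" for m
  proof -
    have "{m' \<in> K. w m' = w m} = {m}" using inj that by (auto simp: inj_on_def)
    then show ?thesis by (simp add: c_def)
  qed
  have poly: "(\<Sum>e\<le>N. c e * t ^ e) = ev (\<lambda>i. t ^ (B ^ i)) p" for t
  proof -
    have "(\<Sum>e\<le>N. c e * t ^ e) =
        (\<Sum>e\<le>N. \<Sum>m \<in> {m \<in> K. w m = e}. real_of_dyadic (Poly_Mapping.lookup p m) * t ^ w m)"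
      by (simp add: c_def sum_distrib_right)
    also have "\<dots> = (\<Sum>m \<in> K. real_of_dyadic (Poly_Mapping.lookup p m) * t ^ w m)"
      using fin wN by (intro sum.group) auto
    finally show ?thesis by (simp add: ev_eq)
  qed
  obtain m where m: "m \<in> K"
    using assms by (auto simp: K_def simp flip: keys_eq_empty)
  then have "c (w m) \<noteq> 0" by (simp add: c K_def in_keys_iff)
  then have "finite {t. (\<Sum>e\<le>N. c e * t ^ e) = 0}"
    using wN[OF m] by (subst polyfun_finite_roots) blast
  \<comment> \<open>Only finitely many \<open>t\<close> are roots, while every \<open>t > 1\<close>
    gives positive and distinct coordinates, hence a generic point.\<close>
  moreover have "infinite {1<..<2::real}" by simp
  ultimately obtain t where t: "t \<in> {1<..<2::real}" "(\<Sum>e\<le>N. c e * t ^ e) \<noteq> 0"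
    by (metis (mono_tags, lifting) finite_subset mem_Collect_eq subsetI)
  have "generic (\<lambda>i. t ^ (B ^ i))"
  proof -
    have "t ^ (B ^ i) > 0" for i using t by simp
    moreover have "t ^ (B ^ i) \<noteq> t ^ (B ^ j)" if "i \<noteq> j" for i j
      using t that by (simp add: B_def)
    ultimately show ?thesis
      unfolding generic_def by (metis add_pos_pos eq_neg_iff_add_eq_0 less_irrefl)
  qed
  then show ?thesis using that t(2) poly by simp
qed

lemma poly_eqI_generic:
  assumes "\<And>x. generic x \<Longrightarrow> ev x p = ev x q"
  shows "p = q"
  using generic_nonzero[of "p - q"] assms by (metis ev_diff eq_iff_diff_eq_0)

section \<open>Divided differences of functions\<close>

type_synonym fn = "(nat \<Rightarrow> real) \<Rightarrow> real"

abbreviation adj :: "nat \<Rightarrow> nat \<Rightarrow> nat" where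
  "adj i \<equiv> transpose i (Suc i)"

definition flip :: "nat set \<Rightarrow> (nat \<Rightarrow> real) \<Rightarrow> nat \<Rightarrow> real" where
  "flip S x = (\<lambda>i. if i \<in> S then - x i else x i)"

definition diff_pos :: "nat \<Rightarrow> fn \<Rightarrow> fn" where
  "diff_pos i F x = (F x - F (x \<circ> adj i)) / (x i - x (Suc i))"

definition diff_zero :: "fn \<Rightarrow> fn" where
  "diff_zero F x = (F x - F (flip {1} x)) / (- x 1)"

definition sign1 :: "fn \<Rightarrow> fn" where
  "sign1 F x = F (flip {1} x)"

text \<open>The substitution of -x_2, -x_1 for x_1, x_2 is the exchange of x_1 and x_2 conjugated by
  the sign change of x_1, which also turns x_1 - x_2 into -x_1 - x_2.\<close>

definition diff_heart :: "fn \<Rightarrow> fn" where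
  "diff_heart F = sign1 (diff_pos 1 (sign1 F))"

definition diff :: "nat \<Rightarrow> fn \<Rightarrow> fn" where
  "diff i = (if i = 0 then diff_zero else diff_pos i)"

lemma comp_adj: "x \<circ> adj i = x(i := x (Suc i), Suc i := x i)"
  by (auto simp: fun_eq_iff transpose_def)

lemma adj_commute: "Suc (Suc i) \<le> j \<Longrightarrow> x \<circ> adj i \<circ> adj j = x \<circ> adj j \<circ> adj i"
  by (auto simp: fun_eq_iff transpose_def)

lemma flip1_adj_commute: "2 \<le> j \<Longrightarrow> flip {1} (x \<circ> adj j) = flip {1} x \<circ> adj j"
  by (auto simp: fun_eq_iff transpose_def flip_def)

lemma flip_in [simp]: "i \<in> S \<Longrightarrow> flip S x i = - x i"
  and flip_notin [simp]: "i \<notin> S \<Longrightarrow> flip S x i = x i"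
  by (simp_all add: flip_def)

text \<open>Transpositions with disjoint supports commute, and each fixes the denominator of the
  other operator. The equality holds at all points, since division distributes over differences even
  when the denominator is 0.\<close>

lemma diff_pos_commute:
  assumes "Suc (Suc i) \<le> j"
  shows "diff_pos i (diff_pos j F) = diff_pos j (diff_pos i F)"
proof
  fix x
  have "adj j i = i" "adj j (Suc i) = Suc i" "adj i j = j" "adj i (Suc j) = Suc j"
    using assms by (auto simp: transpose_def)
  then show "diff_pos i (diff_pos j F) x = diff_pos j (diff_pos i F) x"
    by (simp add: diff_pos_def adj_commute[OF assms] diff_divide_distrib add_divide_distrib algebra_simps)
qed

lemma diff_zero_pos_commute:
  assumes "2 \<le> j"
  shows "diff_zero (diff_pos j F) = diff_pos j (diff_zero F)"
proof
  fix x
  have "adj j (Suc 0) = Suc 0"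
    using assms by (auto simp: transpose_def)
  then show "diff_zero (diff_pos j F) x = diff_pos j (diff_zero F) x"
    using assms flip1_adj_commute[OF assms, of x]
    by (simp add: diff_pos_def diff_zero_def diff_divide_distrib add_divide_distrib algebra_simps)
qed

lemma diff_commute: "i + 2 \<le> j \<Longrightarrow> diff i (diff j F) = diff j (diff i F)"
  using diff_pos_commute[of i j F] diff_zero_pos_commute[of j F] by (simp add: diff_def)

lemma sign1_diff_pos_commute: "2 \<le> j \<Longrightarrow> sign1 (diff_pos j F) = diff_pos j (sign1 F)"
  by (rule ext) (simp add: sign1_def diff_pos_def flip1_adj_commute[simplified] del: o_apply)

lemma sign1_sign1 [simp]: "sign1 (sign1 F) = F"
proof
  fix x :: "nat \<Rightarrow> real"
  have "flip {1} (flip {1} x) = x" by (simp add: flip_def fun_eq_iff)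
  then show "sign1 (sign1 F) x = F x" by (simp add: sign1_def)
qed

lemma diff_heart_commute: "3 \<le> j \<Longrightarrow> diff_heart (diff j F) = diff j (diff_heart F)"
  using diff_pos_commute[of 1 j] by (simp add: diff_heart_def diff_def sign1_diff_pos_commute)

lemma generic_coord_nonzero: "generic x \<Longrightarrow> x i \<noteq> 0"
  and generic_eq_iff: "generic x \<Longrightarrow> x i = x j \<longleftrightarrow> i = j"
  by (auto simp: generic_def)

lemma generic_comp_adj:
  assumes "generic x"
  shows "generic (x \<circ> adj i)"
proof -
  have "adj i j \<noteq> adj i k" if "j \<noteq> k" for j k
    using that by (metis transpose_involutory)
  then show ?thesis using assms by (simp add: generic_def)
qed

lemma generic_flip:
  assumes "generic x"
  shows "generic (flip S x)"
proof -
  have "x i \<noteq> x j \<and> x i \<noteq> - x j \<and> - x i \<noteq> x j \<and> - x i \<noteq> - x j" if "i \<noteq> j" for i j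
    using assms that unfolding generic_def by (metis minus_minus)
  moreover have "x i \<noteq> 0" for i
    using assms by (simp add: generic_def)
  ultimately show ?thesis
    unfolding generic_def flip_def by (auto split del: if_split split: if_split)
qed

text \<open>
  Outside the generic points the functions below take junk values (division by zero), so that
  identities between them are only meaningful up to \<open>generic_eq\<close>.
\<close>

definition generic_eq :: "fn \<Rightarrow> fn \<Rightarrow> bool" where
  "generic_eq F G \<longleftrightarrow> (\<forall>x. generic x \<longrightarrow> F x = G x)"

section \<open>Transfer from operators on polynomials to operators on functions\<close>

lemma generic_eq_trans: "generic_eq F G \<Longrightarrow> generic_eq G H \<Longrightarrow> generic_eq F H"
  by (simp add: generic_eq_def)

lemma generic_eq_sign1: "generic_eq F G \<Longrightarrow> generic_eq (sign1 F) (sign1 G)"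
  by (simp add: generic_eq_def sign1_def generic_flip)

lemma generic_eq_diff: "generic_eq F G \<Longrightarrow> generic_eq (diff i F) (diff i G)"
  by (simp add: generic_eq_def diff_def diff_pos_def diff_zero_def generic_flip generic_comp_adj)

lemma generic_eq_diff_heart: "generic_eq F G \<Longrightarrow> generic_eq (diff_heart F) (diff_heart G)"
  unfolding diff_heart_def using generic_eq_diff[of _ _ 1]
  by (auto simp: diff_def intro!: generic_eq_sign1)

lemma generic_eq_run: "generic_eq F G \<Longrightarrow> generic_eq (run (map diff is) F) (run (map diff is) G)"
  by (induction "is" arbitrary: F G) (simp_all add: generic_eq_diff)

text \<open>Evaluating \<open>dd_mult\<close> or \<open>dd0_mult\<close> gives the quotient times
  its denominator, which is nonzero at a generic point.\<close>

lemma ev_dd: "generic_eq (\<lambda>x. ev x (dd i p)) (diff i (\<lambda>x. ev x p))"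
  unfolding generic_eq_def
proof (intro allI impI)
  fix x assume x: "generic x"
  show "ev x (dd i p) = diff i (\<lambda>x. ev x p) x"
  proof (cases "i = 0")
    case True
    have "(\<lambda>j. ev x ((Var(1 := - Var 1)) j)) = flip {1} x"
      by (simp add: fun_eq_iff flip_def)
    then have "ev x (dd 0 p) * (- x 1) = ev x p - ev (flip {1} x) p"
      using arg_cong[OF dd0_mult[of p], of "ev x"] by (simp add: ev_subst)
    then show ?thesis using generic_coord_nonzero[OF x, of 1] True
      by (simp add: diff_def diff_zero_def field_simps)
  next
    case False
    have "(\<lambda>j. ev x ((Var(i := Var (i + 1), i + 1 := Var i)) j)) = x \<circ> adj i"
      by (simp add: fun_eq_iff comp_adj)
    then have "ev x (dd i p) * (x i - x (Suc i)) = ev x p - ev (x \<circ> adj i) p"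
      using arg_cong[OF dd_mult[of i p], of "ev x"] False by (simp add: ev_subst)
    then show ?thesis using generic_eq_iff[OF x, of i "Suc i"] False
      by (simp add: diff_def diff_pos_def field_simps)
  qed
qed

lemma ev_dd_heart: "generic_eq (\<lambda>x. ev x (dd_heart p)) (diff_heart (\<lambda>x. ev x p))"
  unfolding generic_eq_def
proof (intro allI impI)
  fix x assume x: "generic x"
  \<comment> \<open>The substitution is written as a conjugated exchange, to match
    \<open>diff_heart\<close>.\<close>
  have "(\<lambda>j. ev x ((Var(1 := - Var 2, 2 := - Var 1)) j)) = flip {1} (flip {1} x \<circ> adj 1)"
    by (auto simp: fun_eq_iff flip_def transpose_def numeral_2_eq_2)
  then have "ev x (dd_heart p) * (- x 1 - x 2) = ev x p - ev (flip {1} (flip {1} x \<circ> adj 1)) p"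
    using arg_cong[OF dd_heart_mult[of p], of "ev x"] by (simp add: ev_subst)
  moreover have "x 1 \<noteq> - x 2"
    using x unfolding generic_def by (metis numeral_eq_one_iff semiring_norm(85))
  then have "- x 1 - x 2 \<noteq> 0" by linarith
  moreover have "flip {1} x 1 = - x 1" "flip {1} x (Suc 1) = x 2" "flip {1} (flip {1} x) = x"
    by (simp_all add: flip_def fun_eq_iff numeral_2_eq_2)
  ultimately show "ev x (dd_heart p) = diff_heart (\<lambda>x. ev x p) x"
    unfolding diff_heart_def sign1_def diff_pos_def by (simp only: nonzero_eq_divide_eq simp_thms)
qed

text \<open>\<open>E\<close> describes the effect of \<open>D\<close> on values. Allowing every
  \<open>F\<close> that agrees with \<open>p\<close> at generic points makes the relation stable
  under composition.\<close>

definition lifts :: "(poly \<Rightarrow> poly) \<Rightarrow> (fn \<Rightarrow> fn) \<Rightarrow> bool" where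
  "lifts D E \<longleftrightarrow> (\<forall>p F. generic_eq (\<lambda>x. ev x p) F \<longrightarrow> generic_eq (\<lambda>x. ev x (D p)) (E F))"

lemma lifts_dd: "lifts (dd i) (diff i)"
  unfolding lifts_def using ev_dd generic_eq_diff generic_eq_trans by blast

lemma lifts_dd_heart: "lifts dd_heart diff_heart"
  unfolding lifts_def using ev_dd_heart generic_eq_diff_heart generic_eq_trans by blast

lemma lifts_run: "list_all2 lifts Ds Es \<Longrightarrow> lifts (run Ds) (run Es)"
  by (induction rule: list_all2_induct) (simp_all add: lifts_def)

lemma list_all2_lifts_dd: "list_all2 lifts (map dd is) (map diff is)"
  by (induction "is") (simp_all add: lifts_dd)

lemma nablaB_run: "nablaB k n = run (rowsB dd k n)"
  by (simp add: fun_eq_iff nablaB_def apply_ops_def run_def rowsB_def)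

lemma nablaD_run: "nablaD k n = run (rowsD dd_heart dd k n)"
  by (simp add: fun_eq_iff nablaD_def apply_ops_def run_def rowsD_def)

lemma lifts_nablaB: "lifts (nablaB k n) (run (rowsB diff k n))"
  unfolding nablaB_run
proof (rule lifts_run, induction k)
  case (Suc k)
  then show ?case
    unfolding rowsB_Suc by (rule list_all2_appendI) (rule list_all2_lifts_dd)
qed (simp add: rowsB_def)

lemma lifts_nablaD: "lifts (nablaD k n) (run (rowsD diff_heart diff k n))"
  unfolding nablaD_run
proof (rule lifts_run, induction k)
  case (Suc k)
  then show ?case
    unfolding rowsD_Suc
    by (intro list_all2_appendI list.rel_intros lifts_dd_heart list_all2_lifts_dd)
qed (simp add: rowsD_def)

section \<open>Sums over sign changes\<close>

text \<open>The denominator in t_S. Indexing by two-element subsets instead of pairs i < j lets a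
  permutation of the variables act by mere reindexing.\<close>

definition pair_prod :: "nat set \<Rightarrow> (nat \<Rightarrow> real) \<Rightarrow> real" where
  "pair_prod A y = (\<Prod>B \<in> {B. B \<subseteq> A \<and> card B = 2}. - sum y B)"

lemma pair_prod_empty: "pair_prod {} y = 1"
proof -
  have "{B :: nat set. B \<subseteq> {} \<and> card B = 2} = {}" by auto
  then show ?thesis unfolding pair_prod_def by (simp only: prod.empty)
qed

lemma pair_prod_insert:
  assumes "finite A" "i \<notin> A"
  shows "pair_prod (insert i A) y = pair_prod A y * (\<Prod>j \<in> A. - y i - y j)"
proof -
  have split: "{B. B \<subseteq> insert i A \<and> card B = 2} = {B. B \<subseteq> A \<and> card B = 2} \<union> (\<lambda>j. {i, j}) ` A"
  proof (intro equalityI subsetI)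
    fix B assume B: "B \<in> {B. B \<subseteq> insert i A \<and> card B = 2}"
    show "B \<in> {B. B \<subseteq> A \<and> card B = 2} \<union> (\<lambda>j. {i, j}) ` A"
    proof (cases "i \<in> B")
      case True
      then have "card (B - {i}) = 1" using B by (simp add: card_Diff_singleton)
      then obtain j where "B - {i} = {j}" by (auto simp: card_1_singleton_iff)
      then have "B = {i, j}" "j \<in> A" using True B by auto
      then show ?thesis by auto
    qed (use B in auto)
  qed (use assms in \<open>auto simp: card_insert_if\<close>)
  have inj: "inj_on (\<lambda>j. {i, j}) A" by (auto simp: inj_on_def doubleton_eq_iff)
  have "finite {B. B \<subseteq> A \<and> card B = 2}" using assms by simp
  then have "pair_prod (insert i A) y = pair_prod A y * (\<Prod>B \<in> (\<lambda>j. {i, j}) ` A. - sum y B)"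
    unfolding pair_prod_def split by (intro prod.union_disjoint) (use assms in auto)
  also have "(\<Prod>B \<in> (\<lambda>j. {i, j}) ` A. - sum y B) = (\<Prod>j \<in> A. - sum y {i, j})"
    using inj by (simp add: prod.reindex)
  also have "\<dots> = (\<Prod>j \<in> A. - y i - y j)"
  proof (rule prod.cong)
    fix j assume "j \<in> A"
    then have "i \<noteq> j" using assms by auto
    then show "- sum y {i, j} = - y i - y j" by simp
  qed simp
  finally show ?thesis .
qed

lemma pair_prod_image:
  assumes "inj \<pi>"
  shows "pair_prod A (y \<circ> \<pi>) = pair_prod (\<pi> ` A) y"
proof -
  have inj: "inj_on \<pi> B" for B using assms by (rule inj_on_subset) simp
  have "{B. B \<subseteq> \<pi> ` A \<and> card B = 2} = image \<pi> ` {B. B \<subseteq> A \<and> card B = 2}"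
    using inj by (auto simp: subset_image_iff card_image)
  moreover have "inj_on (image \<pi>) {B. B \<subseteq> A \<and> card B = 2}"
    using assms by (simp add: inj_on_def inj_image_eq_iff)
  ultimately show ?thesis
    using inj by (simp add: pair_prod_def prod.reindex sum.reindex)
qed

lemma pair_prod_nonzero: "finite A \<Longrightarrow> generic y \<Longrightarrow> pair_prod A y \<noteq> 0"
proof (induction A rule: finite_induct)
  case empty
  then show ?case by (simp add: pair_prod_empty)
next
  case (insert i A)
  have "- y i - y j \<noteq> 0" if "j \<in> A" for j
  proof -
    have "i \<noteq> j" using insert.hyps that by auto
    then have "y i \<noteq> - y j" using insert.prems by (simp add: generic_def)
    then show ?thesis by linarith
  qed
  then show ?case using insert by (simp add: pair_prod_insert)
qed

text \<open>The term t_S for an arbitrary set \<open>A\<close> of variables; the Lagrange sums below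
  use sets with one index removed.\<close>

definition flip_term :: "fn \<Rightarrow> nat set \<Rightarrow> nat set \<Rightarrow> fn" where
  "flip_term F A S x = F (flip S x) / pair_prod A (flip S x)"

text \<open>The restriction on \<open>S\<close> depends on its cardinality only, so that
  permutations of the variables preserve it.\<close>

definition flip_sum :: "(nat \<Rightarrow> bool) \<Rightarrow> fn \<Rightarrow> nat set \<Rightarrow> fn" where
  "flip_sum P F A x = (\<Sum>S \<in> {S. S \<subseteq> A \<and> P (card S)}. flip_term F A S x)"

definition sym_fn :: "nat \<Rightarrow> fn \<Rightarrow> bool" where
  "sym_fn n F \<longleftrightarrow> (\<forall>m x. 1 \<le> m \<longrightarrow> m < n \<longrightarrow> F (x \<circ> adj m) = F x)"

lemma sym_fn_mono: "sym_fn n F \<Longrightarrow> m \<le> n \<Longrightarrow> sym_fn m F"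
  by (auto simp: sym_fn_def)

lemma flip_comp: "inj \<pi> \<Longrightarrow> flip S (x \<circ> \<pi>) = flip (\<pi> ` S) x \<circ> \<pi>"
  by (auto simp: flip_def fun_eq_iff inj_image_mem_iff)

text \<open>Replacing \<open>S\<close> by its image under \<open>\<pi>\<close> keeps the cardinality
  and matches the terms one by one.\<close>

lemma flip_sum_comp:
  assumes "inj \<pi>" "\<And>x. F (x \<circ> \<pi>) = F x"
  shows "flip_sum P F A (x \<circ> \<pi>) = flip_sum P F (\<pi> ` A) x"
proof -
  have inj: "inj_on \<pi> B" for B using assms(1) by (rule inj_on_subset) simp
  have "{S. S \<subseteq> \<pi> ` A \<and> P (card S)} = image \<pi> ` {S. S \<subseteq> A \<and> P (card S)}"
    using inj by (auto simp: subset_image_iff card_image)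
  moreover have "inj_on (image \<pi>) {S. S \<subseteq> A \<and> P (card S)}"
    using assms by (simp add: inj_on_def inj_image_eq_iff)
  ultimately show ?thesis
    using assms by (simp add: flip_sum_def sum.reindex flip_term_def flip_comp pair_prod_image)
qed

section \<open>Descending runs of divided differences as Lagrange sums\<close>

text \<open>Downward induction on \<open>m\<close>: \<open>diff m\<close> compares two such sums,
  with nodes \<open>{Suc m..n}\<close> and with \<open>Suc m\<close> replaced by \<open>m\<close>.
  By \<open>equiv\<close> the family \<open>h\<close> is permuted along with the variables, so
  exchanging \<open>x m\<close> and \<open>x (Suc m)\<close> leads from one sum to the
  other.\<close>

lemma run_diff_lagrange:
  assumes equiv: "\<And>i m x. 1 \<le> m \<Longrightarrow> m < n \<Longrightarrow> h i (x \<circ> adj m) = h (adj m i) x"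
    and "1 \<le> m" "m \<le> n" "generic x"
  shows "run (map diff (rev [m..<n])) (h n) x =
    (\<Sum>i \<in> {m..n}. h i x / (\<Prod>j \<in> {m..n} - {i}. x j - x i))"
  using \<open>m \<le> n\<close> \<open>1 \<le> m\<close> \<open>generic x\<close>
proof (induction m arbitrary: x rule: inc_induct)
  case (step m)
  define A where "A = {Suc (Suc m)..n}"
  define p where "p A x i = (\<Prod>j \<in> A - {i}. x j - x i)" for A and x :: "nat \<Rightarrow> real" and i
  define G where "G = run (map diff (rev [Suc m..<n])) (h n)"
  have ne: "x i \<noteq> x j" if "i \<noteq> j" for i j
    using step.prems that by (simp add: generic_def)
  have A: "finite A" "m \<notin> A" "Suc m \<notin> A" "{Suc m..n} = insert (Suc m) A" "{m..n} = insert m (insert (Suc m) A)"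
    using step.hyps by (auto simp: A_def)
  have G: "G x = (\<Sum>i \<in> insert (Suc m) A. h i x / p (insert (Suc m) A) x i)" if "generic x" for x
    unfolding G_def p_def A(4)[symmetric] using step.IH step.prems that by simp
  have adjA: "adj m i = i" if "i \<in> A" for i
    using that by (auto simp: A_def transpose_def)
  have pA: "p (insert (Suc m) A) (x \<circ> adj m) i = p (insert m A) x (adj m i)" if "i \<in> insert (Suc m) A" for i
    unfolding p_def using A that adjA by (cases "i = Suc m") (auto simp: insert_Diff_if)
  have p_ins: "p (insert k A) x i = (x k - x i) * p A x i" if "i \<in> A" "k \<notin> A" for i k
  proof -
    have "insert k A - {i} = insert k (A - {i})" using that by auto
    then show ?thesis using A(1) that by (simp add: p_def)
  qed
  have p_self: "p (insert k A) x k = p A x k" if "k \<notin> A" for k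
    using that by (simp add: p_def)
  have "G (x \<circ> adj m) = (\<Sum>i \<in> insert (Suc m) A. h (adj m i) x / p (insert (Suc m) A) (x \<circ> adj m) i)"
    using G[OF generic_comp_adj[OF step.prems(2)]] equiv step.hyps step.prems by simp
  then have "G (x \<circ> adj m) = h m x / p A x m + (\<Sum>i \<in> A. h i x / ((x m - x i) * p A x i))"
    using A adjA by (simp add: pA p_ins p_self)
  moreover have "G x = h (Suc m) x / p A x (Suc m) + (\<Sum>i \<in> A. h i x / ((x (Suc m) - x i) * p A x i))"
    unfolding G[OF step.prems(2)] using A by (simp add: p_ins p_self)
  \<comment> \<open>The difference of 1 / (x_{m+1} - x_i) and 1 / (x_m - x_i) is (x_m - x_{m+1}) /
    ((x_m - x_i) (x_{m+1} - x_i)): this supplies the additional node.\<close>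
  moreover have "h i x / ((x (Suc m) - x i) * p A x i) - h i x / ((x m - x i) * p A x i) =
      (x m - x (Suc m)) * (h i x / p (insert m (insert (Suc m) A)) x i)" if "i \<in> A" for i
  proof -
    have "p (insert m (insert (Suc m) A)) x i = (x m - x i) * ((x (Suc m) - x i) * p A x i)"
      using A that by (auto simp: p_def insert_Diff_if)
    moreover have "p A x i \<noteq> 0"
      unfolding p_def using A ne by (auto simp: prod_zero_iff)
    moreover have "x m - x i \<noteq> 0" "x (Suc m) - x i \<noteq> 0"
      using A(2,3) ne[of m i] ne[of "Suc m" i] that by auto
    ultimately show ?thesis by (simp add: divide_simps) (simp add: algebra_simps)
  qed
  ultimately have "G x - G (x \<circ> adj m) = h (Suc m) x / p A x (Suc m) - h m x / p A x m +
      (\<Sum>i \<in> A. (x m - x (Suc m)) * (h i x / p (insert m (insert (Suc m) A)) x i))"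
    by (simp add: sum_subtractf[symmetric])
  also have "h (Suc m) x / p A x (Suc m) =
      (x m - x (Suc m)) * (h (Suc m) x / p (insert m (insert (Suc m) A)) x (Suc m))"
    using A ne[of m "Suc m"] by (auto simp: p_def insert_Diff_if)
  also have "h m x / p A x m =
      - ((x m - x (Suc m)) * (h m x / p (insert m (insert (Suc m) A)) x m))"
  proof -
    have eq: "p (insert m (insert (Suc m) A)) x m = (x m - x (Suc m)) * (- p A x m)"
      using A by (simp add: p_def algebra_simps)
    have "x m - x (Suc m) \<noteq> 0" using ne[of m "Suc m"] by simp
    then show ?thesis unfolding eq by simp
  qed
  also have "(x m - x (Suc m)) * (h (Suc m) x / p (insert m (insert (Suc m) A)) x (Suc m)) -
      - ((x m - x (Suc m)) * (h m x / p (insert m (insert (Suc m) A)) x m)) +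
      (\<Sum>i \<in> A. (x m - x (Suc m)) * (h i x / p (insert m (insert (Suc m) A)) x i)) = (x m - x (Suc m)) *
      (\<Sum>i \<in> insert m (insert (Suc m) A). h i x / p (insert m (insert (Suc m) A)) x i)"
    using A by (simp add: distrib_left sum_distrib_left)
  finally have "G x - G (x \<circ> adj m) = (x m - x (Suc m)) *
      (\<Sum>i \<in> insert m (insert (Suc m) A). h i x / p (insert m (insert (Suc m) A)) x i)" .
  then have "diff m G x = (\<Sum>i \<in> insert m (insert (Suc m) A). h i x / p (insert m (insert (Suc m) A)) x i)"
    using step.prems ne[of m "Suc m"] by (simp add: diff_def diff_pos_def)
  moreover have "run (map diff (rev [m..<n])) (h n) = diff m G"
    using step.hyps by (simp add: rev_upt_Suc G_def)
  ultimately show ?case by (simp add: p_def A)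
qed simp

text \<open>Adjoining \<open>i\<close> to the variables multiplies the denominator by the factors
  \<open>- x i - flip S x j\<close>. For \<open>j\<close> in \<open>S\<close> such a factor is
  \<open>x j - x i\<close> and cancels against the Lagrange denominator; the other \<open>j\<close>
  leave the quotients on the right.\<close>

lemma flip_term_extend:
  assumes A: "finite A" and "i \<in> A" "S \<subseteq> A - {i}" and x: "generic x"
  shows "flip_term F (A - {i}) S x / (\<Prod>j \<in> A - {i}. x j - x i) =
    (\<Prod>j \<in> A - S - {i}. (x i + x j) / (x i - x j)) * flip_term F A S x"
proof -
  define y where "y = flip S x"
  have ne: "x j - x i \<noteq> 0" if "j \<noteq> i" for j
    using x that by (simp add: generic_def)
  have "i \<notin> S" using assms by auto
  then have yi: "y i = x i" by (simp add: y_def)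
  have "insert i (A - {i}) = A" using assms by auto
  then have "pair_prod A y = pair_prod (A - {i}) y * (\<Prod>j \<in> A - {i}. - x i - y j)"
    using pair_prod_insert[of "A - {i}" i y] A yi by simp
  moreover have "pair_prod A y \<noteq> 0"
    using A generic_flip[OF x] by (simp add: pair_prod_nonzero y_def)
  ultimately have eq: "F y / pair_prod (A - {i}) y = F y / pair_prod A y * (\<Prod>j \<in> A - {i}. - x i - y j)"
    by (auto simp: field_simps)
  have "(\<Prod>j \<in> A - {i}. - x i - y j) / (\<Prod>j \<in> A - {i}. x j - x i) =
      (\<Prod>j \<in> A - S - {i}. (x i + x j) / (x i - x j))"
  proof -
    have "(\<Prod>j \<in> A - {i}. - x i - y j) / (\<Prod>j \<in> A - {i}. x j - x i) =
        (\<Prod>j \<in> A - {i}. (- x i - y j) / (x j - x i))"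
      by (simp add: prod_dividef)
    also have "\<dots> = (\<Prod>j \<in> A - S - {i}. (- x i - y j) / (x j - x i))"
      using A ne by (intro prod.mono_neutral_right) (auto simp: y_def)
    also have "\<dots> = (\<Prod>j \<in> A - S - {i}. (x i + x j) / (x i - x j))"
    proof (rule prod.cong)
      fix j assume "j \<in> A - S - {i}"
      then have "y j = x j" "x j - x i \<noteq> 0" "x i - x j \<noteq> 0" using ne[of j] by (auto simp: y_def)
      then show "(- x i - y j) / (x j - x i) = (x i + x j) / (x i - x j)" by (simp add: field_simps)
    qed simp
    finally show ?thesis .
  qed
  then have "F y / pair_prod A y * (\<Prod>j \<in> A - {i}. - x i - y j) / (\<Prod>j \<in> A - {i}. x j - x i) =
      (\<Prod>j \<in> A - S - {i}. (x i + x j) / (x i - x j)) * (F y / pair_prod A y)"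
    by (simp only: times_divide_eq_right[symmetric] mult.commute)
  then show ?thesis
    unfolding flip_term_def y_def[symmetric] eq .
qed

text \<open>The Lagrange sum is taken for \<open>\<phi> (x i)\<close> times the flip sum over
  \<open>{1..n} - {i}\<close>. Each term is rewritten over all of \<open>{1..n}\<close>, and the
  sums over \<open>i\<close> and \<open>S\<close> are exchanged. Later \<open>\<phi>\<close> is the
  constant 1 or the identity.\<close>

lemma run_diff_flip_sum:
  assumes F: "sym_fn n F" and x: "generic x" and n: "n \<ge> 1"
  shows "run (map diff (rev [1..<n])) (\<lambda>x. \<phi> (x n) * flip_sum P F ({1..n} - {n}) x) x =
    (\<Sum>S \<in> {S. S \<subseteq> {1..n} \<and> P (card S)}.
      (\<Sum>i \<in> {1..n} - S. \<phi> (x i) * (\<Prod>j \<in> {1..n} - S - {i}. (x i + x j) / (x i - x j))) *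
      flip_term F {1..n} S x)"
proof -
  define A where "A = {1..n}"
  define h where "h i x = \<phi> (x i) * flip_sum P F (A - {i}) x" for i x
  define L where "L = {S. S \<subseteq> A \<and> P (card S)}"
  define c where "c S i = (\<Prod>j \<in> A - S - {i}. (x i + x j) / (x i - x j))" for S i
  have fin: "finite A" "finite L" by (simp_all add: A_def L_def)
  have equiv: "h i (x \<circ> adj m) = h (adj m i) x" if "1 \<le> m" "m < n" for i m x
  proof -
    have "adj m ` A = A"
      using that by (intro permutes_image permutes_swap_id) (auto simp: A_def)
    then have "adj m ` (A - {i}) = A - {adj m i}"
      by (simp add: image_set_diff)
    then show ?thesis
      using F that by (simp add: h_def flip_sum_comp sym_fn_def)
  qed
  have "run (map diff (rev [1..<n])) (h n) x = (\<Sum>i \<in> A. h i x / (\<Prod>j \<in> A - {i}. x j - x i))"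
    unfolding A_def by (rule run_diff_lagrange[of n h 1 x, OF equiv]) (use x n in simp_all)
  also have "\<dots> = (\<Sum>i \<in> A. \<Sum>S \<in> {S \<in> L. i \<notin> S}. \<phi> (x i) * c S i * flip_term F A S x)"
  proof (rule sum.cong)
    fix i assume i: "i \<in> A"
    have "{S. S \<subseteq> A - {i} \<and> P (card S)} = {S \<in> L. i \<notin> S}"
      by (auto simp: L_def)
    then have "h i x / (\<Prod>j \<in> A - {i}. x j - x i) = (\<Sum>S \<in> {S \<in> L. i \<notin> S}.
        \<phi> (x i) * (flip_term F (A - {i}) S x / (\<Prod>j \<in> A - {i}. x j - x i)))"
      by (simp add: h_def flip_sum_def sum_divide_distrib sum_distrib_left)
    also have "\<dots> = (\<Sum>S \<in> {S \<in> L. i \<notin> S}. \<phi> (x i) * c S i * flip_term F A S x)"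
      unfolding c_def using i fin x by (intro sum.cong refl) (subst flip_term_extend, auto simp: L_def)
    finally show "h i x / (\<Prod>j \<in> A - {i}. x j - x i) =
      (\<Sum>S \<in> {S \<in> L. i \<notin> S}. \<phi> (x i) * c S i * flip_term F A S x)" .
  qed simp
  also have "\<dots> = (\<Sum>S \<in> L. \<Sum>i \<in> {i \<in> A. i \<notin> S}. \<phi> (x i) * c S i * flip_term F A S x)"
    using fin by (intro sum.swap_restrict)
  also have "\<dots> = (\<Sum>S \<in> L. (\<Sum>i \<in> A - S. \<phi> (x i) * c S i) * flip_term F A S x)"
    by (simp add: sum_distrib_right set_diff_eq)
  finally show ?thesis unfolding h_def A_def L_def c_def .
qed

lemma flip_sum_coeff:
  fixes x :: "nat \<Rightarrow> real"
  assumes "generic x" "S \<subseteq> {1..n}"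
  shows "(\<Sum>i \<in> {1..n} - S. \<Prod>j \<in> {1..n} - S - {i}. (x i + x j) / (x i - x j)) =
      (if odd (n - card S) then 1 else 0)"
    and "(\<Sum>i \<in> {1..n} - S. x i * (\<Prod>j \<in> {1..n} - S - {i}. (x i + x j) / (x i - x j))) =
      sum x ({1..n} - S)"
proof -
  have inj: "inj_on x ({1..n} - S)" and "\<forall>i. x i \<noteq> 0"
    using assms(1) by (auto simp: inj_on_def generic_def)
  moreover have "card ({1..n} - S) = n - card S"
    using assms(2) by (simp add: card_Diff_subset finite_subset[OF assms(2)])
  ultimately show "(\<Sum>i \<in> {1..n} - S. \<Prod>j \<in> {1..n} - S - {i}. (x i + x j) / (x i - x j)) =
      (if odd (n - card S) then 1 else 0)"
    by (simp add: sum_prod_quotient)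
  show "(\<Sum>i \<in> {1..n} - S. x i * (\<Prod>j \<in> {1..n} - S - {i}. (x i + x j) / (x i - x j))) =
      sum x ({1..n} - S)"
    using inj by (intro sum_times_prod_quotient) auto
qed

text \<open>For constant \<open>\<phi>\<close> the coefficient of t_S is 1 or 0, so the run acts as
  a filter: it keeps the terms in which an odd number of variables keep their sign.\<close>

lemma run_diff_flip_sum_1:
  assumes "sym_fn (Suc n) F"
  shows "generic_eq (run (map diff (rev [1..<Suc n])) (flip_sum P F {1..n}))
    (flip_sum (\<lambda>s. P s \<and> odd (Suc n - s)) F {1..Suc n})"
  unfolding generic_eq_def
proof (intro allI impI)
  fix x assume x: "generic x"
  have A: "{1..Suc n} - {Suc n} = {1..n}" by auto
  have "run (map diff (rev [1..<Suc n])) (flip_sum P F {1..n}) x =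
    (\<Sum>S \<in> {S. S \<subseteq> {1..Suc n} \<and> P (card S)}.
      (\<Sum>i \<in> {1..Suc n} - S. \<Prod>j \<in> {1..Suc n} - S - {i}. (x i + x j) / (x i - x j)) *
      flip_term F {1..Suc n} S x)"
    using run_diff_flip_sum[OF assms x, of "\<lambda>_. 1" P] unfolding A by (simp only: mult_1)
  also have "\<dots> = (\<Sum>S \<in> {S. S \<subseteq> {1..Suc n} \<and> P (card S)}.
      (if odd (Suc n - card S) then 1 else 0) * flip_term F {1..Suc n} S x)"
    by (intro sum.cong refl arg_cong2[of _ _ _ _ "(*)"] flip_sum_coeff(1)[OF x]) simp
  also have "\<dots> = flip_sum (\<lambda>s. P s \<and> odd (Suc n - s)) F {1..Suc n} x"
    unfolding flip_sum_def
    by (intro sum.mono_neutral_cong_right) (auto intro: finite_subset[of _ "Pow {1..Suc n}"])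
  finally show "run (map diff (rev [1..<Suc n])) (flip_sum P F {1..n}) x =
    flip_sum (\<lambda>s. P s \<and> odd (Suc n - s)) F {1..Suc n} x" .
qed

text \<open>For \<open>\<phi>\<close> the identity, the coefficient of t_S is the sum of the
  variables that keep their sign.\<close>

lemma run_diff_flip_sum_var:
  assumes "sym_fn (Suc n) F"
  shows "generic_eq (run (map diff (rev [1..<Suc n])) (\<lambda>x. x (Suc n) * flip_sum P F {1..n} x))
    (\<lambda>x. \<Sum>S \<in> {S. S \<subseteq> {1..Suc n} \<and> P (card S)}. sum x ({1..Suc n} - S) * flip_term F {1..Suc n} S x)"
  unfolding generic_eq_def
proof (intro allI impI)
  fix x assume x: "generic x"
  have A: "{1..Suc n} - {Suc n} = {1..n}" by auto
  have "run (map diff (rev [1..<Suc n])) (\<lambda>x. x (Suc n) * flip_sum P F {1..n} x) x =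
    (\<Sum>S \<in> {S. S \<subseteq> {1..Suc n} \<and> P (card S)}.
      (\<Sum>i \<in> {1..Suc n} - S. x i * (\<Prod>j \<in> {1..Suc n} - S - {i}. (x i + x j) / (x i - x j))) *
      flip_term F {1..Suc n} S x)"
    using run_diff_flip_sum[OF assms x, of "\<lambda>u. u" P] unfolding A by simp
  also have "\<dots> = (\<Sum>S \<in> {S. S \<subseteq> {1..Suc n} \<and> P (card S)}.
      sum x ({1..Suc n} - S) * flip_term F {1..Suc n} S x)"
    by (intro sum.cong refl arg_cong2[of _ _ _ _ "(*)"] flip_sum_coeff(2)[OF x]) simp
  finally show "run (map diff (rev [1..<Suc n])) (\<lambda>x. x (Suc n) * flip_sum P F {1..n} x) x =
    (\<Sum>S \<in> {S. S \<subseteq> {1..Suc n} \<and> P (card S)}. sum x ({1..Suc n} - S) * flip_term F {1..Suc n} S x)" .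
qed

section \<open>Action of the sign change of x_1 on the index sets\<close>

definition toggle :: "nat set \<Rightarrow> nat set" where
  "toggle S = (if 1 \<in> S then S - {1} else insert 1 S)"

lemma toggle_toggle [simp]: "toggle (toggle S) = S"
  by (auto simp: toggle_def)

lemma flip_toggle: "flip S (flip {1} x) = flip (toggle S) x"
  by (auto simp: fun_eq_iff flip_def toggle_def)

lemma toggle_subset: "1 \<in> A \<Longrightarrow> toggle S \<subseteq> A \<longleftrightarrow> S \<subseteq> A"
  by (auto simp: toggle_def)

lemma even_card_toggle: "finite S \<Longrightarrow> even (card (toggle S)) \<longleftrightarrow> odd (card S)"
  by (auto simp: toggle_def card_Diff_singleton card_gt_0_iff intro: card_ge_0_finite)

lemma flip_term_flip1: "flip_term F A S (flip {1} x) = flip_term F A (toggle S) x"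
  by (simp only: flip_term_def flip_toggle)

text \<open>The sign change of x_1 replaces \<open>S\<close> by \<open>toggle S\<close>, whose
  cardinality has the opposite parity.\<close>

lemma sign1_flip_sum:
  assumes "finite A" "1 \<in> A"
  shows "sign1 (flip_sum (\<lambda>s. even s = b) F A) = flip_sum (\<lambda>s. even s = (\<not> b)) F A"
proof
  fix x
  show "sign1 (flip_sum (\<lambda>s. even s = b) F A) x = flip_sum (\<lambda>s. even s = (\<not> b)) F A x"
    unfolding sign1_def flip_sum_def flip_term_flip1
    by (rule sum.reindex_bij_witness[of _ toggle toggle])
      (use assms in \<open>auto simp: toggle_subset even_card_toggle finite_subset\<close>)
qed

text \<open>After reindexing by \<open>toggle\<close>, the sign change of x_1 has lowered every
  coefficient by x_1. Hence the numerator is \<open>c * x 1\<close> times the plain sum, and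
  division by -x_1 leaves the factor \<open>- c\<close>.\<close>

lemma diff_zero_flip_sum:
  assumes "finite A" "1 \<in> A"
  shows "generic_eq (diff 0 (\<lambda>x. c * (\<Sum>S \<in> {S. S \<subseteq> A}. sum x (A - S) * flip_term F A S x)))
    (\<lambda>x. - c * (\<Sum>S \<in> {S. S \<subseteq> A}. flip_term F A S x))"
  unfolding generic_eq_def
proof (intro allI impI)
  fix x assume "generic x"
  then have x1: "x 1 \<noteq> 0" by (simp add: generic_def)
  have "(\<Sum>S \<in> {S. S \<subseteq> A}. sum (flip {1} x) (A - S) * flip_term F A (toggle S) x) =
      (\<Sum>S \<in> {S. S \<subseteq> A}. sum (flip {1} x) (A - toggle S) * flip_term F A S x)"
    by (rule sum.reindex_bij_witness[of _ toggle toggle]) (use assms in \<open>auto simp: toggle_subset\<close>)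
  also have "\<dots> = (\<Sum>S \<in> {S. S \<subseteq> A}. (sum x (A - S) - x 1) * flip_term F A S x)"
  proof (rule sum.cong)
    fix S assume "S \<in> {S. S \<subseteq> A}"
    \<comment> \<open>The common part of \<open>A - S\<close> and \<open>A - toggle S\<close>;
      exactly one of the two also contains 1.\<close>
    define B where "B = A - insert 1 S"
    have B: "finite B" "1 \<notin> B" using assms by (simp_all add: B_def)
    then have eq: "sum (flip {1} x) B = sum x B"
      by (intro sum.cong refl flip_notin) auto
    have "sum (flip {1} x) (A - toggle S) = sum x (A - S) - x 1"
    proof (cases "1 \<in> S")
      case True
      then have "A - toggle S = insert 1 B" "A - S = B"
        using assms by (auto simp: toggle_def B_def)
      then show ?thesis using B eq by (simp add: sum.insert[OF B])
    next
      case False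
      then have "A - toggle S = B" "A - S = insert 1 B"
        using assms by (auto simp: toggle_def B_def)
      then show ?thesis using B eq by (simp add: sum.insert[OF B])
    qed
    then show "sum (flip {1} x) (A - toggle S) * flip_term F A S x = (sum x (A - S) - x 1) * flip_term F A S x"
      by simp
  qed simp
  also have "\<dots> = (\<Sum>S \<in> {S. S \<subseteq> A}. sum x (A - S) * flip_term F A S x) -
      x 1 * (\<Sum>S \<in> {S. S \<subseteq> A}. flip_term F A S x)"
    by (simp only: left_diff_distrib sum_subtractf sum_distrib_left)
  finally have eq: "(\<Sum>S \<in> {S. S \<subseteq> A}. sum (flip {1} x) (A - S) * flip_term F A (toggle S) x) =
      (\<Sum>S \<in> {S. S \<subseteq> A}. sum x (A - S) * flip_term F A S x) -
      x 1 * (\<Sum>S \<in> {S. S \<subseteq> A}. flip_term F A S x)" .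
  have "(c * T - c * (T - x 1 * U)) / - x 1 = - c * U" for T U
    using x1 by (simp add: right_diff_distrib)
  then show "diff 0 (\<lambda>x. c * (\<Sum>S \<in> {S. S \<subseteq> A}. sum x (A - S) * flip_term F A S x)) x =
      - c * (\<Sum>S \<in> {S. S \<subseteq> A}. flip_term F A S x)"
    unfolding diff_def diff_zero_def if_P[OF refl] flip_term_flip1 eq .
qed

section \<open>Images of symmetric functions under the operator products\<close>

lemma sym_fn_mult_var: "sym_fn n F \<Longrightarrow> sym_fn n (\<lambda>x. F x * x (Suc n))"
  by (auto simp: sym_fn_def transpose_def)

text \<open>The index \<open>n\<close> lies outside \<open>A\<close>, so no sign change in the sum
  affects \<open>x n\<close>.\<close>

lemma flip_sum_mult_var:
  assumes "\<And>i. i \<in> A \<Longrightarrow> i < n"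
  shows "flip_sum P (\<lambda>x. F x * x n) A x = x n * flip_sum P F A x"
proof -
  have "flip_term (\<lambda>x. F x * x n) A S x = x n * flip_term F A S x" if "S \<subseteq> A" for S
  proof -
    have "n \<notin> S" using assms that by blast
    then show ?thesis by (simp add: flip_term_def)
  qed
  then show ?thesis by (simp add: flip_sum_def sum_distrib_left)
qed

lemma run_diff_mult_const:
  "run (map diff is) (\<lambda>x. c * F x) = (\<lambda>x. c * run (map diff is) F x)"
proof (induction "is" arbitrary: F)
  case (Cons i "is")
  have "diff i (\<lambda>x. c * F x) = (\<lambda>x. c * diff i F x)"
    by (simp add: fun_eq_iff diff_def diff_pos_def diff_zero_def right_diff_distrib)
  then show ?case using Cons by simp
qed simp

lemma flip_sum_empty: "flip_sum P F {} x = (if P 0 then F x else 0)"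
proof -
  have "{S :: nat set. S = {} \<and> P (card S)} = (if P 0 then {{}} else {})" by auto
  moreover have "flip {} x = x" by (simp add: flip_def)
  ultimately show ?thesis by (simp add: flip_sum_def flip_term_def pair_prod_empty)
qed

lemma generic_eq_mult: "generic_eq F G \<Longrightarrow> generic_eq (\<lambda>x. c * F x) (\<lambda>x. c * G x)"
  by (simp add: generic_eq_def)

text \<open>
  The variable $x_{n+1}$ is a constant for the operators of the first $n$ rows, so the induction
  hypothesis applies to $F x_{n+1}$.
\<close>

lemma run_rowsB_full:
  assumes "sym_fn n F"
  shows "generic_eq (run (rowsB diff n n) (\<lambda>x. F x * (\<Prod>i = 1..n. x i)))
    (\<lambda>x. (- 1) ^ n * flip_sum (\<lambda>_. True) F {1..n} x)"
  using assms
proof (induction n arbitrary: F)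
  case 0
  then show ?case by (simp add: rowsB_def flip_sum_empty generic_eq_def)
next
  case (Suc n)
  let ?c = "(- 1) ^ n :: real" and ?is = "rev [1..<Suc n]"
  have var: "flip_sum (\<lambda>_. True) (\<lambda>x. F x * x (Suc n)) {1..n} x = x (Suc n) * flip_sum (\<lambda>_. True) F {1..n} x" for x
    by (rule flip_sum_mult_var) simp
  have prod: "(\<lambda>x. F x * (\<Prod>i = 1..Suc n. x i)) = (\<lambda>x. F x * x (Suc n) * (\<Prod>i = 1..n. x i))"
    by (simp add: fun_eq_iff)
  have "sym_fn n (\<lambda>x. F x * x (Suc n))"
    using Suc.prems by (intro sym_fn_mult_var) (auto intro: sym_fn_mono)
  from Suc.IH[OF this]
  have "generic_eq (run (rowsB diff n n) (\<lambda>x. F x * (\<Prod>i = 1..Suc n. x i)))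
      (\<lambda>x. ?c * (x (Suc n) * flip_sum (\<lambda>_. True) F {1..n} x))"
    unfolding prod var .
  then have "generic_eq (run (map diff ?is) (run (rowsB diff n n) (\<lambda>x. F x * (\<Prod>i = 1..Suc n. x i))))
      (\<lambda>x. ?c * run (map diff ?is) (\<lambda>x. x (Suc n) * flip_sum (\<lambda>_. True) F {1..n} x) x)"
    unfolding run_diff_mult_const[symmetric] by (rule generic_eq_run)
  \<comment> \<open>The descending run turns the factor x_{n+1} into the sum of the variables that
    keep their sign.\<close>
  also note generic_eq_mult[OF run_diff_flip_sum_var[OF Suc.prems]]
  finally (generic_eq_trans) have "generic_eq (diff 0 (run (map diff ?is) (run (rowsB diff n n) (\<lambda>x. F x * (\<Prod>i = 1..Suc n. x i)))))
      (diff 0 (\<lambda>x. ?c * (\<Sum>S \<in> {S. S \<subseteq> {1..Suc n}}. sum x ({1..Suc n} - S) * flip_term F {1..Suc n} S x)))"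
    by (intro generic_eq_diff) (simp del: upt_Suc)
  \<comment> \<open>\<open>diff 0\<close> removes these coefficients and contributes the last factor
    -1.\<close>
  then have "generic_eq (diff 0 (run (map diff ?is) (run (rowsB diff n n) (\<lambda>x. F x * (\<Prod>i = 1..Suc n. x i)))))
      (\<lambda>x. - ?c * (\<Sum>S \<in> {S. S \<subseteq> {1..Suc n}}. flip_term F {1..Suc n} S x))"
    by (rule generic_eq_trans) (rule diff_zero_flip_sum, simp_all)
  then show ?case
    by (simp add: run_rowsB_diag[of diff, OF diff_commute] flip_sum_def del: upt_Suc)
qed

text \<open>The formula for \<open>n\<close> variables is followed by the descending run alone,
  without a final \<open>diff 0\<close>; there is no factor x_{n+1}, so the run acts as the parity
  filter.\<close>

lemma run_rowsB_penultimate: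
  assumes "sym_fn (Suc n) F"
  shows "generic_eq (run (rowsB diff n (Suc n)) (\<lambda>x. F x * (\<Prod>i = 1..n. x i)))
    (\<lambda>x. (- 1) ^ n * flip_sum (\<lambda>s. odd (Suc n - s)) F {1..Suc n} x)"
proof -
  let ?c = "(- 1) ^ n :: real" and ?is = "rev [1..<Suc n]"
  have "generic_eq (run (map diff ?is) (run (rowsB diff n n) (\<lambda>x. F x * (\<Prod>i = 1..n. x i))))
      (\<lambda>x. ?c * run (map diff ?is) (flip_sum (\<lambda>_. True) F {1..n}) x)"
    unfolding run_diff_mult_const[symmetric]
    using assms by (intro generic_eq_run run_rowsB_full) (auto intro: sym_fn_mono)
  also note generic_eq_mult[OF run_diff_flip_sum_1[OF assms, of "\<lambda>_. True"]]
  finally (generic_eq_trans) show ?thesis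
    using run_rowsB_Suc[of diff n n, OF diff_commute] by (simp del: upt_Suc)
qed

lemma flip_sum_cong:
  assumes "finite A" "\<And>s. s \<le> card A \<Longrightarrow> P s = Q s"
  shows "flip_sum P F A = flip_sum Q F A"
proof -
  have "{S. S \<subseteq> A \<and> P (card S)} = {S. S \<subseteq> A \<and> Q (card S)}"
    using assms by (auto simp: card_mono)
  then show ?thesis by (simp add: flip_sum_def fun_eq_iff)
qed

text \<open>Two variables are added per step. The first descending run adds one; the second,
  completed by the heart operator, is a full descending run conjugated by the sign change of x_1 and
  adds the other.\<close>

lemma run_rowsD:
  assumes "sym_fn (2 * k) F"
  shows "generic_eq (run (rowsD diff_heart diff k (2 * k)) F) (flip_sum even F {1..2 * k})"
  using assms
proof (induction k)
  case 0
  then show ?case by (simp add: rowsD_def flip_sum_empty generic_eq_def)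
next
  case (Suc k)
  define E where "E b n = flip_sum (\<lambda>s. even s = b) F {1..n}" for b n
  define R where "R n = run (map diff (rev [1..<Suc n]))" for n
  \<comment> \<open>If the cardinalities of the \<open>S\<close> have the parity of
    \<open>n\<close>, then \<open>Suc n - card S\<close> is always odd and the filter drops
    nothing.\<close>
  have E_step: "generic_eq (R n (E b n)) (E b (Suc n))" if "even n = b" "n < 2 * Suc k" for n b
  proof -
    have "sym_fn (Suc n) F" using Suc.prems that by (auto intro: sym_fn_mono)
    from run_diff_flip_sum_1[OF this, of "\<lambda>s. even s = b"] show ?thesis
      unfolding E_def R_def using that
      by (subst flip_sum_cong[of "{1..Suc n}" "\<lambda>s. even s = b" "\<lambda>s. even s = b \<and> odd (Suc n - s)"]) auto
  qed
  have E_sign: "sign1 (E b n) = E (\<not> b) n" if "n \<ge> 1" for n b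
    unfolding E_def using that by (intro sign1_flip_sum) auto
  have R_cong: "generic_eq F G \<Longrightarrow> generic_eq (R n F) (R n G)" for F G n
    unfolding R_def by (rule generic_eq_run)
  \<comment> \<open>The sign change commutes with the operators of index at least 2, so the
    conjugation extends from the operator of index 1 to the whole run.\<close>
  have heart: "diff_heart (run (map diff (rev [2..<2 * k + 2])) G) = sign1 (R (2 * k + 1) (sign1 G))" for G
  proof -
    have "sign1 (run (map diff is) G) = run (map diff is) (sign1 G)" if "\<forall>i \<in> set is. 2 \<le> i" for "is" G
      by (rule run_commute1) (use that in \<open>auto simp: diff_def sign1_diff_pos_commute\<close>)
    moreover have "rev [1..<Suc (2 * k + 1)] = rev [2..<2 * k + 2] @ [1]"
      using rev_upt_Suc[of 1 "Suc (2 * k + 1)"] by (simp add: numeral_2_eq_2 del: upt_Suc)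
    ultimately show ?thesis
      unfolding R_def by (simp add: diff_heart_def diff_def del: upt_Suc)
  qed
  have "generic_eq (run (rowsD diff_heart diff k (2 * k)) F) (E True (2 * k))"
    using Suc by (simp add: E_def sym_fn_mono)
  from generic_eq_trans[OF R_cong[OF this] E_step]
  have "generic_eq (R (2 * k) (run (rowsD diff_heart diff k (2 * k)) F)) (E True (2 * k + 1))"
    by simp
  \<comment> \<open>The sign change passes from even to odd sets, matching the parity of
    \<open>2 * k + 1\<close>.\<close>
  from R_cong[OF generic_eq_sign1[OF this]]
  have "generic_eq (R (2 * k + 1) (sign1 (R (2 * k) (run (rowsD diff_heart diff k (2 * k)) F))))
      (R (2 * k + 1) (E False (2 * k + 1)))"
    by (simp add: E_sign)
  from generic_eq_sign1[OF generic_eq_trans[OF this E_step]]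
  have "generic_eq (sign1 (R (2 * k + 1) (sign1 (R (2 * k) (run (rowsD diff_heart diff k (2 * k)) F)))))
      (E True (2 * Suc k))"
    by (simp add: E_sign)
  moreover have "run (rowsD diff_heart diff (Suc k) (2 * Suc k)) F =
      sign1 (R (2 * k + 1) (sign1 (R (2 * k) (run (rowsD diff_heart diff k (2 * k)) F))))"
    unfolding heart[symmetric] unfolding R_def Suc_eq_plus1[of "2 * k"]
    by (rule run_rowsD_diag, erule diff_commute, erule diff_heart_commute)
  ultimately show ?case
    by (simp only: E_def simp_thms)
qed

section \<open>Comparison of the sums over sign changes\<close>

lemma flip_sum_parity_split:
  assumes "finite A"
  shows "flip_sum (\<lambda>_. True) F A x = flip_sum even F A x + flip_sum odd F A x"
proof -
  let ?E = "{S. S \<subseteq> A \<and> even (card S)}" and ?O = "{S. S \<subseteq> A \<and> odd (card S)}"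
  have "finite ?E" "finite ?O" using assms by simp_all
  moreover have "?E \<inter> ?O = {}" by blast
  ultimately have "(\<Sum>S \<in> ?E \<union> ?O. flip_term F A S x) = flip_sum even F A x + flip_sum odd F A x"
    unfolding flip_sum_def by (rule sum.union_disjoint)
  moreover have "?E \<union> ?O = {S. S \<subseteq> A \<and> True}" by blast
  ultimately show ?thesis unfolding flip_sum_def by (simp only:)
qed

lemma generic_eqD: "generic_eq F G \<Longrightarrow> generic x \<Longrightarrow> F x = G x"
  by (simp add: generic_eq_def)

lemma liftsD: "lifts D E \<Longrightarrow> generic_eq (\<lambda>x. ev x p) F \<Longrightarrow> generic x \<Longrightarrow> ev x (D p) = E F x"
  unfolding lifts_def by (rule generic_eqD) blast+

lemma sym_fn_ev:
  assumes "f \<in> Sym n"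
  shows "sym_fn n (\<lambda>x. ev x f)"
  unfolding sym_fn_def
proof (intro allI impI)
  fix m and x :: "nat \<Rightarrow> real"
  assume "1 \<le> m" "m < n"
  then have "adj m permutes {1..n}" by (intro permutes_swap_id) auto
  then have "subst (\<lambda>i. Var (adj m i)) f = f" using assms by (simp add: Sym_def)
  then have "ev x f = ev (\<lambda>i. x (adj m i)) f" using ev_subst[of x "\<lambda>i. Var (adj m i)" f] by simp
  then show "ev (x \<circ> adj m) f = ev x f" by (simp add: comp_def)
qed

theorem proposition6:
  fixes k :: nat and f :: poly
  assumes "k \<ge> 1" and "f \<in> Sym (2 * k)"
  shows "nablaD k (2 * k) f =
         nablaB (2 * k) (2 * k) (f * (\<Prod>i = 1..2 * k. Var i)) +
         nablaB (2 * k - 1) (2 * k) (f * (\<Prod>i = 1..2 * k - 1. Var i))"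
proof (rule poly_eqI_generic)
  fix x assume x: "generic x"
  define F where "F = (\<lambda>x. ev x f)"
  define n where "n = 2 * k - 1"
  have n: "2 * k = Suc n" using assms(1) unfolding n_def by linarith
  then have "odd n" by presburger
  have F: "sym_fn (2 * k) F" unfolding F_def using assms(2) by (rule sym_fn_ev)
  have nablaB: "ev x (nablaB l m (f * (\<Prod>i = 1..l. Var i))) =
      run (rowsB diff l m) (\<lambda>x. F x * (\<Prod>i = 1..l. x i)) x" for l m
    by (rule liftsD[OF lifts_nablaB _ x]) (simp add: generic_eq_def F_def)
  have "ev x (nablaD k (2 * k) f) = run (rowsD diff_heart diff k (2 * k)) F x"
    by (rule liftsD[OF lifts_nablaD _ x]) (simp add: generic_eq_def F_def)
  also have "\<dots> = flip_sum even F {1..2 * k} x"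
    by (rule generic_eqD[OF run_rowsD[OF F] x])
  also have "\<dots> = flip_sum (\<lambda>_. True) F {1..2 * k} x - flip_sum odd F {1..2 * k} x"
    using flip_sum_parity_split[of "{1..2 * k}" F x] by simp
  \<comment> \<open>As \<open>Suc n\<close> is even, \<open>card S\<close> and
    \<open>Suc n - card S\<close> have the same parity.\<close>
  also have "flip_sum odd F {1..2 * k} x = flip_sum (\<lambda>s. odd (Suc n - s)) F {1..Suc n} x"
    unfolding n using \<open>odd n\<close> by (subst flip_sum_cong[of _ odd "\<lambda>s. odd (Suc n - s)"]) auto
  also have "flip_sum (\<lambda>_. True) F {1..2 * k} x =
      ev x (nablaB (2 * k) (2 * k) (f * (\<Prod>i = 1..2 * k. Var i)))"
    unfolding nablaB generic_eqD[OF run_rowsB_full[OF F] x] by simp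
  \<comment> \<open>As \<open>n\<close> is odd, the sign is -1, and the subtracted sum becomes the
    second summand.\<close>
  also have "flip_sum (\<lambda>s. odd (Suc n - s)) F {1..Suc n} x =
      - ev x (nablaB n (2 * k) (f * (\<Prod>i = 1..n. Var i)))"
    unfolding nablaB n generic_eqD[OF run_rowsB_penultimate[OF F[unfolded n]] x]
    using \<open>odd n\<close> by simp
  finally show "ev x (nablaD k (2 * k) f) =
      ev x (nablaB (2 * k) (2 * k) (f * (\<Prod>i = 1..2 * k. Var i)) +
         nablaB (2 * k - 1) (2 * k) (f * (\<Prod>i = 1..2 * k - 1. Var i)))"
    by (simp add: n_def)
qed

end
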